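(* Let $G$ be a countable directed graph. If $\lambda$ is a left-bounded left weight on $G$ whose canonical right companion $\rho$ is right-bounded, then $\mathfrak{L}(G,\lambda)$ coincides with its double commutant: $\mathfrak{L}(G,\lambda)''=\mathfrak{L}(G,\lambda)$.
   Context: $G$ is a countable directed graph (multiple edges and loops allowed) with vertex set $V(G)$ and edge set $E(G)$. $G^+$ is the set of all finite directed paths in $G$, including the vertices as paths of length $0$; $s(w)$, $r(w)$ are the source and range vertices of a path $w$, with $s(x)=r(x)=x$ for $x\in V(G)$. Paths are composed right to left: $w=r(w)\,w\,s(w)$, and for $v,w\in G^+$ one has $wv\in G^+$ if and only if $s(w)=r(v)$. $\mathcal{H}_G=\ell^2(G^+)$ with canonical orthonormal basis $\{\xi_v : v\in G^+\}$; commutants are taken in $\mathcal{B}(\mathcal{H}_G)$. A left weight on $G$ is a function $\lambda: G^+\times G^+\to[0,\infty)$ such that $\lambda(v,w)>0\iff wv\in G^+$, and $\lambda(v,w_2w_1)=\lambda(w_1v,w_2)\lambda(v,w_1)$ whenever $w_2w_1v\in G^+$. Put $\lambda(w)=\sup_{v\in G^+}\lambda(v,w)\in[0,\infty]$. $\lambda$ is left-bounded if $\lambda(w)<\infty$ for all $w\in G^+$. If $\lambda(w)<\infty$, $L_{\lambda,w}\in\mathcal{B}(\mathcal{H}_G)$ is the bounded operator with $L_{\lambda,w}\xi_v=\lambda(v,w)\xi_{wv}$ if $wv\in G^+$ and $L_{\lambda,w}\xi_v=0$ otherwise. $\mathfrak{L}(G,\lambda)$ is the WOT-closed unital operator algebra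 generated by $\{L_{\lambda,w}: w\in G^+,\ \lambda(w)<\infty\}$. A right weight on $G$ is a function $\rho:G^+\times G^+\to[0,\infty)$ such that $\rho(v,u)>0\iff vu\in G^+$, and $\rho(v,u_1u_2)=\rho(vu_1,u_2)\rho(v,u_1)$ whenever $vu_1u_2\in G^+$. Put $\rho(u)=\sup_{v\in G^+}\rho(v,u)\in[0,\infty]$. $\rho$ is right-bounded if $\rho(u)<\infty$ for all $u\in G^+$. A right weight $\rho$ is a right companion to $\lambda$ if $\rho(wv,u)\lambda(v,w)=\lambda(vu,w)\rho(v,u)$ for all $v,w,u\in G^+$ with $wvu\in G^+$. It is canonical if moreover $\rho(r(e),e)=\lambda(s(e),e)$ for all $e\in E(G)$. Every left weight has exactly one canonical right companion. *)

theory Defs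
  imports "HOL-Analysis.Analysis" "Graph_Theory.Arc_Walk"
begin

section \<open>Hilbert space and bounded operators\<close>

text \<open>
  Vectors of \<open>\<ell>\<^sup>2(I)\<close> are functions on the ambient type that vanish off \<open>I\<close>.
\<close>

definition l2 :: "'i set \<Rightarrow> ('i \<Rightarrow> complex) set" where
  "l2 I = {f. (\<forall>i. i \<notin> I \<longrightarrow> f i = 0) \<and> (\<lambda>i. (cmod (f i))\<^sup>2) summable_on I}"

definition l2_inner :: "'i set \<Rightarrow> ('i \<Rightarrow> complex) \<Rightarrow> ('i \<Rightarrow> complex) \<Rightarrow> complex" where
  "l2_inner I f g = (\<Sum>\<^sub>\<infinity>i\<in>I. f i * cnj (g i))"

definition l2_norm :: "'i set \<Rightarrow> ('i \<Rightarrow> complex) \<Rightarrow> real" where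
  "l2_norm I f = sqrt (\<Sum>\<^sub>\<infinity>i\<in>I. (cmod (f i))\<^sup>2)"

definition ket :: "'i \<Rightarrow> 'i \<Rightarrow> complex" where
  "ket v = (\<lambda>i. if i = v then 1 else 0)"

text \<open>
  Operators on \<open>\<ell>\<^sup>2(I)\<close> are normalised to be 0 off \<open>l2 I\<close>, so that equality of HOL functions is
  equality of operators.  This normalisation is stable under pointwise linear combinations and
  under composition.
\<close>

definition bounded_ops :: "'i set \<Rightarrow> (('i \<Rightarrow> complex) \<Rightarrow> 'i \<Rightarrow> complex) set" where
  "bounded_ops I = {T.
     (\<forall>f\<in>l2 I. T f \<in> l2 I) \<and>
     (\<forall>f. f \<notin> l2 I \<longrightarrow> T f = (\<lambda>_. 0)) \<and>
     (\<forall>f\<in>l2 I. \<forall>g\<in>l2 I. \<forall>a b.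
        T (\<lambda>i. a * f i + b * g i) = (\<lambda>i. a * T f i + b * T g i)) \<and>
     (\<exists>C. \<forall>f\<in>l2 I. l2_norm I (T f) \<le> C * l2_norm I f)}"

definition id_op :: "'i set \<Rightarrow> ('i \<Rightarrow> complex) \<Rightarrow> 'i \<Rightarrow> complex" where
  "id_op I = (\<lambda>f. if f \<in> l2 I then f else (\<lambda>_. 0))"

lemma l2_zero: "(\<lambda>_. 0) \<in> l2 I"
  by (simp add: l2_def)

lemma l2_finite_support:
  assumes "finite F" "F \<subseteq> I" "\<And>i. i \<notin> F \<Longrightarrow> f i = 0"
  shows "f \<in> l2 I"
proof -
  have "(\<lambda>i. (cmod (f i))\<^sup>2) summable_on F"
    using assms(1) by simp
  then have "(\<lambda>i. (cmod (f i))\<^sup>2) summable_on I"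
    by (subst summable_on_cong_neutral[where T = F]) (use assms in auto)
  then show ?thesis
    using assms by (auto simp: l2_def)
qed

lemma ket_in_l2: "v \<in> I \<Longrightarrow> ket v \<in> l2 I"
  by (rule l2_finite_support[of "{v}"]) (auto simp: ket_def)

lemma cmod_add_sq: "(cmod (x + y))\<^sup>2 \<le> 2 * (cmod x)\<^sup>2 + 2 * (cmod y)\<^sup>2"
proof -
  have "(cmod (x + y))\<^sup>2 \<le> (cmod x + cmod y)\<^sup>2"
    by (intro power_mono norm_triangle_ineq) auto
  also have "\<dots> \<le> 2 * (cmod x)\<^sup>2 + 2 * (cmod y)\<^sup>2"
    using sum_squares_bound[of "cmod x" "cmod y"] by (simp add: power2_sum)
  finally show ?thesis .
qed

lemma l2_lincomb:
  assumes "f \<in> l2 I" "g \<in> l2 I"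
  shows "(\<lambda>i. a * f i + b * g i) \<in> l2 I"
proof -
  have "(\<lambda>i. 2 * (cmod a)\<^sup>2 * (cmod (f i))\<^sup>2 + 2 * (cmod b)\<^sup>2 * (cmod (g i))\<^sup>2) summable_on I"
    using assms by (intro summable_on_add summable_on_cmult_right) (auto simp: l2_def)
  then have "(\<lambda>i. (cmod (a * f i + b * g i))\<^sup>2) summable_on I"
  proof (rule summable_on_comparison_test)
    show "(cmod (a * f i + b * g i))\<^sup>2
        \<le> 2 * (cmod a)\<^sup>2 * (cmod (f i))\<^sup>2 + 2 * (cmod b)\<^sup>2 * (cmod (g i))\<^sup>2" for i
      using cmod_add_sq[of "a * f i" "b * g i"]
      by (simp add: norm_mult power_mult_distrib mult.assoc)
  qed simp
  then show ?thesis
    using assms by (auto simp: l2_def)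
qed

lemma l2_coord_le_norm:
  assumes "f \<in> l2 I"
  shows "cmod (f i) \<le> l2_norm I f"
proof (cases "i \<in> I")
  case True
  have "sum (\<lambda>i. (cmod (f i))\<^sup>2) {i} \<le> (\<Sum>\<^sub>\<infinity>i\<in>I. (cmod (f i))\<^sup>2)"
    by (rule finite_sum_le_infsum) (use assms True in \<open>auto simp: l2_def\<close>)
  then show ?thesis
    by (simp add: l2_norm_def real_le_rsqrt)
next
  case False
  then show ?thesis
    using assms by (auto simp: l2_def l2_norm_def intro!: infsum_nonneg)
qed

lemma l2_approx:
  assumes f: "f \<in> l2 I" and "\<epsilon> > 0"
  obtains F where "finite F" "F \<subseteq> I" "l2_norm I (\<lambda>i. 1 * f i + (-1) * (if i \<in> F then f i else 0)) \<le> \<epsilon>"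
proof -
  let ?q = "\<lambda>i. (cmod (f i))\<^sup>2"
  have sm: "?q summable_on I"
    using f by (simp add: l2_def)
  obtain F where F: "finite F" "F \<subseteq> I" "dist (sum ?q F) (infsum ?q I) \<le> \<epsilon>\<^sup>2"
    using infsum_finite_approximation[OF sm, of "\<epsilon>\<^sup>2"] \<open>\<epsilon> > 0\<close> by auto
  have "infsum (\<lambda>i. (cmod (1 * f i + (-1) * (if i \<in> F then f i else 0)))\<^sup>2) I = infsum ?q (I - F)"
    by (rule infsum_cong_neutral) auto
  also have "\<dots> = infsum ?q I - infsum ?q F"
    by (rule infsum_Diff) (use sm F in auto)
  also have "\<dots> \<le> \<epsilon>\<^sup>2"
    using F by (auto simp: dist_real_def)
  finally have "l2_norm I (\<lambda>i. 1 * f i + (-1) * (if i \<in> F then f i else 0)) \<le> sqrt (\<epsilon>\<^sup>2)"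
    unfolding l2_norm_def by (rule real_sqrt_le_mono)
  then show ?thesis
    using that[OF F(1,2)] \<open>\<epsilon> > 0\<close> by simp
qed

lemma bounded_ops_eqI:
  assumes S: "S \<in> bounded_ops I" and T: "T \<in> bounded_ops I"
    and eq: "\<And>v. v \<in> I \<Longrightarrow> S (ket v) = T (ket v)"
  shows "S = T"
proof
  fix f
  have lin: "X (\<lambda>i. a * f i + b * g i) = (\<lambda>i. a * X f i + b * X g i)"
    if "X \<in> bounded_ops I" "f \<in> l2 I" "g \<in> l2 I" for X a b f g
    using that by (simp add: bounded_ops_def)
  show "S f = T f"
  proof (cases "f \<in> l2 I")
    case False
    then show ?thesis using S T by (simp add: bounded_ops_def)
  next
    case f: True
    define tr where "tr F = (\<lambda>i. if i \<in> F then f i else 0)" for F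
    have tr_l2: "tr F \<in> l2 I" if "finite F" "F \<subseteq> I" for F
      using that by (intro l2_finite_support[of F]) (auto simp: tr_def)
    have tr_eq: "S (tr F) = T (tr F)" if "finite F" "F \<subseteq> I" for F
      using that
    proof (induction F)
      case empty
      have "tr {} = (\<lambda>i. 0 * 0 + 0 * 0)"
        by (simp add: tr_def)
      then show ?case
        using lin[OF S l2_zero l2_zero, of 0 0] lin[OF T l2_zero l2_zero, of 0 0] by simp
    next
      case (insert v F)
      then have v: "v \<in> I" and F: "finite F" "F \<subseteq> I" and IH: "S (tr F) = T (tr F)"
        by auto
      have "tr (insert v F) = (\<lambda>i. 1 * tr F i + f v * ket v i)"
        using insert(2) by (auto simp: tr_def ket_def)
      then show ?case
        by (simp only: lin[OF S tr_l2[OF F] ket_in_l2[OF v]] lin[OF T tr_l2[OF F] ket_in_l2[OF v]]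
            IH eq[OF v])
    qed
    obtain C D where C: "\<And>g. g \<in> l2 I \<Longrightarrow> l2_norm I (S g) \<le> C * l2_norm I g"
      and D: "\<And>g. g \<in> l2 I \<Longrightarrow> l2_norm I (T g) \<le> D * l2_norm I g"
      using S T unfolding bounded_ops_def mem_Collect_eq by metis
    define K where "K = \<bar>C\<bar> + \<bar>D\<bar> + 1"
    have "K > 0" by (simp add: K_def)
    have "cmod (S f i - T f i) \<le> \<epsilon>" if "\<epsilon> > 0" for \<epsilon> i
    proof -
      obtain F where F: "finite F" "F \<subseteq> I"
        and le: "l2_norm I (\<lambda>i. 1 * f i + (-1) * (if i \<in> F then f i else 0)) \<le> \<epsilon> / K"
        using l2_approx[OF f, of "\<epsilon> / K"] \<open>\<epsilon> > 0\<close> \<open>K > 0\<close> by auto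
      define g where "g = (\<lambda>i. 1 * f i + (-1) * tr F i)"
      have g: "g \<in> l2 I"
        unfolding g_def using f tr_l2[OF F] by (rule l2_lincomb)
      have gle: "l2_norm I g \<le> \<epsilon> / K"
        using le by (simp add: g_def tr_def)
      have g0: "l2_norm I g \<ge> 0"
        by (auto simp: l2_norm_def intro!: infsum_nonneg)
      have "S f i - T f i = S g i - T g i"
        unfolding g_def lin[OF S f tr_l2[OF F]] lin[OF T f tr_l2[OF F]] by (simp add: tr_eq[OF F])
      also have "cmod \<dots> \<le> cmod (S g i) + cmod (T g i)"
        by (rule norm_triangle_ineq4)
      also have "\<dots> \<le> l2_norm I (S g) + l2_norm I (T g)"
        using S T g by (intro add_mono l2_coord_le_norm) (auto simp: bounded_ops_def)
      also have "\<dots> \<le> C * l2_norm I g + D * l2_norm I g"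
        by (intro add_mono C D g)
      also have "\<dots> = (C + D) * l2_norm I g"
        by (simp add: algebra_simps)
      also have "\<dots> \<le> K * l2_norm I g"
        using g0 by (intro mult_right_mono) (auto simp: K_def)
      also have "\<dots> \<le> K * (\<epsilon> / K)"
        using gle \<open>K > 0\<close> by (intro mult_left_mono) auto
      also have "\<dots> = \<epsilon>"
        using \<open>K > 0\<close> by simp
      finally show ?thesis .
    qed
    then have "cmod (S f i - T f i) \<le> 0" for i
      using field_le_epsilon[of "cmod (S f i - T f i)" 0] by simp
    then show ?thesis by auto
  qed
qed

lemma weighted_shift_exists:
  fixes a :: "'i \<Rightarrow> real"
  assumes c: "inj_on c W" "c ` W \<subseteq> I" and W: "W \<subseteq> I"
    and a: "\<And>v. v \<in> W \<Longrightarrow> 0 \<le> a v" "\<And>v. v \<in> W \<Longrightarrow> a v \<le> C"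
  shows "\<exists>T\<in>bounded_ops I. \<forall>v\<in>I. T (ket v) =
    (if v \<in> W then (\<lambda>u. complex_of_real (a v) * ket (c v) u) else (\<lambda>_. 0))"
proof -
  define d where "d = inv_into W c"
  have dc: "d (c v) = v" if "v \<in> W" for v
    using that c by (simp add: d_def)
  define A where "A f = (\<lambda>u. if u \<in> c ` W then complex_of_real (a (d u)) * f (d u) else 0)" for f
  define T where "T f = (if f \<in> l2 I then A f else (\<lambda>_. 0))" for f
  have A: "A f \<in> l2 I \<and> l2_norm I (A f) \<le> \<bar>C\<bar> * l2_norm I f" if f: "f \<in> l2 I" for f
  proof -
    let ?q = "\<lambda>u. (cmod (A f u))\<^sup>2"
    have q: "?q (c v) \<le> C\<^sup>2 * (cmod (f v))\<^sup>2" if "v \<in> W" for v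
      using that a[OF that] dc[OF that]
      by (auto simp: A_def norm_mult power_mult_distrib intro!: mult_right_mono power_mono)
    have smI: "(\<lambda>v. C\<^sup>2 * (cmod (f v))\<^sup>2) summable_on I"
      using f by (intro summable_on_cmult_right) (auto simp: l2_def)
    then have "(\<lambda>v. C\<^sup>2 * (cmod (f v))\<^sup>2) summable_on W"
      using W by (rule summable_on_subset)
    then have smW: "(?q \<circ> c) summable_on W"
      by (rule summable_on_comparison_test) (use q in auto)
    then have "?q summable_on c ` W"
      by (simp add: summable_on_reindex[OF c(1)])
    then have sm: "?q summable_on I"
      by (subst summable_on_cong_neutral[where T = "c ` W"]) (use c in \<open>auto simp: A_def\<close>)
    have "infsum ?q I = infsum ?q (c ` W)"
      by (rule infsum_cong_neutral) (use c in \<open>auto simp: A_def\<close>)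
    also have "\<dots> = infsum (?q \<circ> c) W"
      by (rule infsum_reindex[OF c(1)])
    also have "\<dots> \<le> infsum (\<lambda>v. C\<^sup>2 * (cmod (f v))\<^sup>2) I"
      by (rule infsum_mono_neutral[OF smW smI]) (use q W in auto)
    also have "\<dots> = C\<^sup>2 * infsum (\<lambda>v. (cmod (f v))\<^sup>2) I"
      by (rule infsum_cmult_right')
    finally have "sqrt (infsum ?q I) \<le> sqrt (C\<^sup>2 * infsum (\<lambda>v. (cmod (f v))\<^sup>2) I)"
      by (rule real_sqrt_le_mono)
    then have "l2_norm I (A f) \<le> \<bar>C\<bar> * l2_norm I f"
      by (simp add: l2_norm_def real_sqrt_mult)
    moreover have "A f \<in> l2 I"
      using sm c by (auto simp: l2_def A_def)
    ultimately show ?thesis by simp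
  qed
  have "T \<in> bounded_ops I"
    unfolding bounded_ops_def mem_Collect_eq
  proof (intro conjI ballI allI impI)
    show "\<exists>C. \<forall>f\<in>l2 I. l2_norm I (T f) \<le> C * l2_norm I f"
      using A by (auto simp: T_def)
    show "T (\<lambda>i. x * f i + y * g i) = (\<lambda>i. x * T f i + y * T g i)"
      if "f \<in> l2 I" "g \<in> l2 I" for f g x y
      using that by (simp add: T_def l2_lincomb) (simp add: A_def fun_eq_iff algebra_simps)
  qed (use A in \<open>auto simp: T_def\<close>)
  moreover have "T (ket v) = (if v \<in> W then (\<lambda>u. complex_of_real (a v) * ket (c v) u) else (\<lambda>_. 0))"
    if "v \<in> I" for v
    using ket_in_l2[OF that] dc by (auto simp: T_def A_def ket_def fun_eq_iff)
  ultimately show ?thesis by blast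
qed

text \<open>
  The weak operator topology: the initial topology for the maps \<open>T \<mapsto> \<langle>T f, g\<rangle>\<close>.
\<close>

definition wot :: "'i set \<Rightarrow> (('i \<Rightarrow> complex) \<Rightarrow> 'i \<Rightarrow> complex) topology" where
  "wot I = topology_generated_by
     {{T \<in> bounded_ops I. l2_inner I (T f) g \<in> U} | f g U. f \<in> l2 I \<and> g \<in> l2 I \<and> open U}"

definition unital_subalgebra ::
    "'i set \<Rightarrow> (('i \<Rightarrow> complex) \<Rightarrow> 'i \<Rightarrow> complex) set \<Rightarrow> bool" where
  "unital_subalgebra I A \<longleftrightarrow>
     A \<subseteq> bounded_ops I \<and> id_op I \<in> A \<and>
     (\<forall>S\<in>A. \<forall>T\<in>A. (\<lambda>f i. S f i + T f i) \<in> A) \<and>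
     (\<forall>c. \<forall>T\<in>A. (\<lambda>f i. c * T f i) \<in> A) \<and>
     (\<forall>S\<in>A. \<forall>T\<in>A. S \<circ> T \<in> A)"

definition wot_algebra_generated ::
    "'i set \<Rightarrow> (('i \<Rightarrow> complex) \<Rightarrow> 'i \<Rightarrow> complex) set
       \<Rightarrow> (('i \<Rightarrow> complex) \<Rightarrow> 'i \<Rightarrow> complex) set" where
  "wot_algebra_generated I X = (\<lambda>A. unital_subalgebra I A \<and> closedin (wot I) A) hull X"

definition commutant ::
    "'i set \<Rightarrow> (('i \<Rightarrow> complex) \<Rightarrow> 'i \<Rightarrow> complex) set
       \<Rightarrow> (('i \<Rightarrow> complex) \<Rightarrow> 'i \<Rightarrow> complex) set" where
  "commutant I X = {T \<in> bounded_ops I. \<forall>S\<in>X. T \<circ> S = S \<circ> T}"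

section \<open>Paths\<close>

text \<open>
  A path is a pair \<open>(x, es)\<close> of its source vertex and the list of its arcs in order of traversal;
  \<open>(x, [])\<close> is the vertex \<open>x\<close> regarded as a path of length 0.  The product \<open>path_comp w v\<close>, written
  \<open>wv\<close> in right-to-left notation, traverses \<open>v\<close> first and then \<open>w\<close>.
\<close>

type_synonym ('v, 'e) gpath = "'v \<times> 'e list"

definition paths :: "('v, 'e) pre_digraph \<Rightarrow> ('v, 'e) gpath set" where
  "paths G = {(x, es). \<exists>y. pre_digraph.awalk G x es y}"

definition path_src :: "('v, 'e) gpath \<Rightarrow> 'v" where
  "path_src w = fst w"

definition path_rng :: "('v, 'e) pre_digraph \<Rightarrow> ('v, 'e) gpath \<Rightarrow> 'v" where
  "path_rng G w = pre_digraph.awlast G (fst w) (snd w)"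

definition vertex_path :: "'v \<Rightarrow> ('v, 'e) gpath" where
  "vertex_path x = (x, [])"

definition edge_path :: "('v, 'e) pre_digraph \<Rightarrow> 'e \<Rightarrow> ('v, 'e) gpath" where
  "edge_path G e = (tail G e, [e])"

definition composable ::
    "('v, 'e) pre_digraph \<Rightarrow> ('v, 'e) gpath \<Rightarrow> ('v, 'e) gpath \<Rightarrow> bool" where
  "composable G w v \<longleftrightarrow> w \<in> paths G \<and> v \<in> paths G \<and> path_src w = path_rng G v"

definition path_comp :: "('v, 'e) gpath \<Rightarrow> ('v, 'e) gpath \<Rightarrow> ('v, 'e) gpath" where
  "path_comp w v = (fst v, snd v @ snd w)"

section \<open>Weights\<close>

text \<open>Only the values of a weight on pairs of paths are meaningful.\<close>

type_synonym ('v, 'e) weight = "('v, 'e) gpath \<Rightarrow> ('v, 'e) gpath \<Rightarrow> real"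

definition left_weight :: "('v, 'e) pre_digraph \<Rightarrow> ('v, 'e) weight \<Rightarrow> bool" where
  "left_weight G l \<longleftrightarrow>
     (\<forall>v\<in>paths G. \<forall>w\<in>paths G. 0 \<le> l v w \<and> (l v w > 0 \<longleftrightarrow> composable G w v)) \<and>
     (\<forall>v w1 w2. composable G w2 w1 \<and> composable G w1 v \<longrightarrow>
        l v (path_comp w2 w1) = l (path_comp w1 v) w2 * l v w1)"

definition right_weight :: "('v, 'e) pre_digraph \<Rightarrow> ('v, 'e) weight \<Rightarrow> bool" where
  "right_weight G r \<longleftrightarrow>
     (\<forall>v\<in>paths G. \<forall>u\<in>paths G. 0 \<le> r v u \<and> (r v u > 0 \<longleftrightarrow> composable G v u)) \<and>
     (\<forall>v u1 u2. composable G v u1 \<and> composable G u1 u2 \<longrightarrow>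
        r v (path_comp u1 u2) = r (path_comp v u1) u2 * r v u1)"

text \<open>The quantity \<open>\<lambda>(w) = sup\<^sub>v \<lambda>(v,w)\<close>; the same formula serves right weights.\<close>

definition weight_sup :: "('v, 'e) pre_digraph \<Rightarrow> ('v, 'e) weight \<Rightarrow> ('v, 'e) gpath \<Rightarrow> ennreal" where
  "weight_sup G l w = (SUP v\<in>paths G. ennreal (l v w))"

definition left_bounded :: "('v, 'e) pre_digraph \<Rightarrow> ('v, 'e) weight \<Rightarrow> bool" where
  "left_bounded G l \<longleftrightarrow> (\<forall>w\<in>paths G. weight_sup G l w < \<infinity>)"

definition right_bounded :: "('v, 'e) pre_digraph \<Rightarrow> ('v, 'e) weight \<Rightarrow> bool" where
  "right_bounded G r \<longleftrightarrow> (\<forall>u\<in>paths G. weight_sup G r u < \<infinity>)"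

definition right_companion ::
    "('v, 'e) pre_digraph \<Rightarrow> ('v, 'e) weight \<Rightarrow> ('v, 'e) weight \<Rightarrow> bool" where
  "right_companion G l r \<longleftrightarrow>
     right_weight G r \<and>
     (\<forall>v w u. composable G w v \<and> composable G v u \<longrightarrow>
        r (path_comp w v) u * l v w = l (path_comp v u) w * r v u)"

definition canonical_right_companion ::
    "('v, 'e) pre_digraph \<Rightarrow> ('v, 'e) weight \<Rightarrow> ('v, 'e) weight \<Rightarrow> bool" where
  "canonical_right_companion G l r \<longleftrightarrow>
     right_companion G l r \<and>
     (\<forall>e\<in>arcs G. r (vertex_path (head G e)) (edge_path G e)
                 = l (vertex_path (tail G e)) (edge_path G e))"

section \<open>Weighted left creation operators\<close>

text \<open>
  The description is proper whenever \<open>\<lambda>(w) < \<infinity>\<close>; see \<open>ex1_left_op\<close> below.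
\<close>

definition left_op ::
    "('v, 'e) pre_digraph \<Rightarrow> ('v, 'e) weight \<Rightarrow> ('v, 'e) gpath
       \<Rightarrow> (('v, 'e) gpath \<Rightarrow> complex) \<Rightarrow> ('v, 'e) gpath \<Rightarrow> complex" where
  "left_op G l w = (THE T. T \<in> bounded_ops (paths G) \<and>
     (\<forall>v\<in>paths G. T (ket v) =
        (if composable G w v
         then (\<lambda>u. complex_of_real (l v w) * ket (path_comp w v) u)
         else (\<lambda>_. 0))))"

lemma path_comp_in_paths:
  assumes "wf_digraph G" "composable G w v"
  shows "path_comp w v \<in> paths G"
proof -
  interpret wf_digraph G by fact
  obtain y z where wv: "awalk (fst w) (snd w) y" "awalk (fst v) (snd v) z"
    using assms(2) by (auto simp: composable_def paths_def)
  then have "awalk (fst v) (snd v @ snd w) y"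
    using assms(2) by (auto simp: composable_def path_src_def path_rng_def)
  then show ?thesis
    by (auto simp: paths_def path_comp_def)
qed

lemma ex1_left_op:
  assumes "wf_digraph G" and l: "left_weight G l" and w: "w \<in> paths G"
    and fin: "weight_sup G l w < \<infinity>"
  shows "\<exists>!T. T \<in> bounded_ops (paths G) \<and>
     (\<forall>v\<in>paths G. T (ket v) =
        (if composable G w v
         then (\<lambda>u. complex_of_real (l v w) * ket (path_comp w v) u)
         else (\<lambda>_. 0)))"
proof (rule ex_ex1I)
  let ?W = "{v. composable G w v}"
  have le: "l v w \<le> enn2real (weight_sup G l w)" if "v \<in> paths G" for v
  proof -
    have "ennreal (l v w) \<le> weight_sup G l w"
      unfolding weight_sup_def using that by (rule SUP_upper)
    also have "\<dots> = ennreal (enn2real (weight_sup G l w))"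
      using fin by simp
    finally show ?thesis
      by simp
  qed
  have "inj_on (path_comp w) ?W"
    by (auto simp: inj_on_def path_comp_def prod_eq_iff)
  moreover have "path_comp w ` ?W \<subseteq> paths G"
    by (intro image_subsetI path_comp_in_paths[OF assms(1)]) simp
  moreover have "?W \<subseteq> paths G"
    by (auto simp: composable_def)
  ultimately have "\<exists>T\<in>bounded_ops (paths G). \<forall>v\<in>paths G. T (ket v) =
      (if v \<in> ?W then (\<lambda>u. complex_of_real (l v w) * ket (path_comp w v) u) else (\<lambda>_. 0))"
    by (rule weighted_shift_exists[where C = "enn2real (weight_sup G l w)"])
      (use l w le in \<open>auto simp: left_weight_def composable_def\<close>)
  then show "\<exists>T. T \<in> bounded_ops (paths G) \<and>
     (\<forall>v\<in>paths G. T (ket v) =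
        (if composable G w v
         then (\<lambda>u. complex_of_real (l v w) * ket (path_comp w v) u)
         else (\<lambda>_. 0)))"
    by (simp add: Bex_def)
qed (auto intro: bounded_ops_eqI)

definition left_algebra ::
    "('v, 'e) pre_digraph \<Rightarrow> ('v, 'e) weight
       \<Rightarrow> ((('v, 'e) gpath \<Rightarrow> complex) \<Rightarrow> ('v, 'e) gpath \<Rightarrow> complex) set" where
  "left_algebra G l = wot_algebra_generated (paths G)
     {left_op G l w | w. w \<in> paths G \<and> weight_sup G l w < \<infinity>}"

end

theory Submission
  imports Defs
begin

text \<open>
  The companion identity makes the weighted right creation operators \<open>R\<^sub>u\<close>, with
  \<open>R\<^sub>u \<xi>\<^sub>v = \<rho>(v,u) \<xi>\<^sub>v\<^sub>u\<close>, commute with all \<open>L\<^sub>\<lambda>\<^sub>,\<^sub>w\<close>; hence every \<open>A\<close> in the double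
  commutant commutes with all \<open>R\<^sub>u\<close>.  Since \<open>\<xi>\<^sub>v\<close> is a multiple of \<open>R\<^sub>v \<xi>\<^sub>x\<close> for \<open>x = r(v)\<close>,
  such an \<open>A\<close> is determined by its values on the vertex vectors, and comparing coefficients gives
  \<open>A\<close> the formal expansion \<open>\<Sum>\<^sub>w a\<^sub>w L\<^sub>\<lambda>\<^sub>,\<^sub>w\<close>.  Its part of degree \<open>j\<close> is the WOT limit of the
  sums over finite sets of paths of length \<open>j\<close>, which are cut-downs of that part by coordinate
  projections and so uniformly bounded.  The Cesaro means of the degree expansion are averages of
  compressions of \<open>A\<close> to windows of consecutive path lengths; they are bounded by \<open>\<parallel>A\<parallel>\<close> and converge to
  \<open>A\<close> coordinatewise, hence in the weak operator topology.
\<close>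

section \<open>Operators on square-summable functions\<close>

text \<open>The coordinate projection onto \<open>X\<close>. Since \<open>X\<close> need not lie
  inside \<open>I\<close>, level sets and complements in the whole index type can be used
  directly.\<close>

definition restr :: "'i set \<Rightarrow> ('i \<Rightarrow> complex) \<Rightarrow> 'i \<Rightarrow> complex" where
  "restr X f = (\<lambda>i. if i \<in> X then f i else 0)"

lemma restr_apply: "restr X f i = (if i \<in> X then f i else 0)"
  by (simp add: restr_def)

text \<open>\<open>bounded_ops\<close> only asserts that some bound exists; the limit arguments need
  one explicit constant shared by a whole family of operators.\<close>

definition op_bound :: "'i set \<Rightarrow> real \<Rightarrow> (('i \<Rightarrow> complex) \<Rightarrow> 'i \<Rightarrow> complex) \<Rightarrow> bool" where
  "op_bound I C T \<longleftrightarrow> (\<forall>f\<in>l2 I. l2_norm I (T f) \<le> C * l2_norm I f)"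

lemma l2_norm_nonneg: "0 \<le> l2_norm I f"
  by (simp add: l2_norm_def infsum_nonneg)

lemma l2_norm_sq: "(l2_norm I f)\<^sup>2 = (\<Sum>\<^sub>\<infinity>i\<in>I. (cmod (f i))\<^sup>2)"
  by (simp add: l2_norm_def infsum_nonneg)

lemma l2_sum_le:
  assumes "f \<in> l2 I" "finite F" "F \<subseteq> I"
  shows "(\<Sum>i\<in>F. (cmod (f i))\<^sup>2) \<le> (l2_norm I f)\<^sup>2"
  unfolding l2_norm_sq
  by (rule finite_sum_le_infsum) (use assms in \<open>auto simp: l2_def\<close>)

text \<open>Nonnegative terms with bounded finite partial sums are summable, and the sum inherits
  the bound. Norm estimates for homogeneous parts and Cesaro means thereby reduce to finite sums,
  whose order can be exchanged freely.\<close>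

lemma l2_finite_sum_bound:
  assumes "\<And>i. i \<notin> I \<Longrightarrow> f i = 0" and "0 \<le> B"
    and F: "\<And>F. finite F \<Longrightarrow> F \<subseteq> I \<Longrightarrow> (\<Sum>i\<in>F. (cmod (f i))\<^sup>2) \<le> B\<^sup>2"
  shows "f \<in> l2 I" and "l2_norm I f \<le> B"
proof -
  have sm: "(\<lambda>i. (cmod (f i))\<^sup>2) summable_on I"
    by (rule nonneg_bdd_above_summable_on) (use F in \<open>auto intro!: bdd_aboveI[of _ "B\<^sup>2"]\<close>)
  then show "f \<in> l2 I"
    using assms(1) by (simp add: l2_def)
  have "(\<Sum>\<^sub>\<infinity>i\<in>I. (cmod (f i))\<^sup>2) \<le> B\<^sup>2"
    by (rule infsum_le_finite_sums[OF sm]) (use F in auto)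
  then show "l2_norm I f \<le> B"
    using \<open>0 \<le> B\<close> by (simp add: l2_norm_sq[symmetric] power2_le_iff_abs_le l2_norm_nonneg)
qed

lemma restr_l2:
  assumes "f \<in> l2 I"
  shows "restr X f \<in> l2 I" and "l2_norm I (restr X f) \<le> l2_norm I f"
proof -
  have "(\<Sum>i\<in>F. (cmod (restr X f i))\<^sup>2) \<le> (l2_norm I f)\<^sup>2" if "finite F" "F \<subseteq> I" for F
    using order_trans[OF sum_mono l2_sum_le[OF assms that]] by (auto simp: restr_def)
  note l2_finite_sum_bound[OF _ _ this]
  then show "restr X f \<in> l2 I" "l2_norm I (restr X f) \<le> l2_norm I f"
    using assms by (auto simp: restr_def l2_norm_nonneg l2_def)
qed

text \<open>Valid for every function \<open>f\<close>, because operators are normalised to be 0 off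
  \<open>l2 I\<close> and 0 lies in \<open>l2 I\<close>.\<close>

lemma bounded_ops_l2: "T \<in> bounded_ops I \<Longrightarrow> T f \<in> l2 I"
  by (cases "f \<in> l2 I") (auto simp: bounded_ops_def l2_zero)

lemma bounded_ops_outside: "T \<in> bounded_ops I \<Longrightarrow> f \<notin> l2 I \<Longrightarrow> T f = (\<lambda>_. 0)"
  by (simp add: bounded_ops_def)

lemma bounded_ops_lincomb:
  assumes "T \<in> bounded_ops I" "f \<in> l2 I" "g \<in> l2 I"
  shows "T (\<lambda>i. a * f i + b * g i) = (\<lambda>i. a * T f i + b * T g i)"
  using assms by (simp add: bounded_ops_def)

lemma bounded_ops_scale:
  assumes "T \<in> bounded_ops I" "f \<in> l2 I"
  shows "T (\<lambda>i. a * f i) = (\<lambda>i. a * T f i)"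
  using bounded_ops_lincomb[OF assms assms(2), of a 0] by simp

lemma bounded_ops_zero:
  assumes "T \<in> bounded_ops I"
  shows "T (\<lambda>_. 0) = (\<lambda>_. 0)"
  using bounded_ops_scale[OF assms l2_zero, of 0] by simp

lemma bounded_ops_add:
  assumes "T \<in> bounded_ops I" "f \<in> l2 I" "g \<in> l2 I"
  shows "T (\<lambda>i. f i + g i) = (\<lambda>i. T f i + T g i)"
  using bounded_ops_lincomb[OF assms, of 1 1] by simp

lemma l2_sum:
  assumes "finite J" "\<And>n. n \<in> J \<Longrightarrow> f n \<in> l2 I"
  shows "(\<lambda>i. \<Sum>n\<in>J. f n i) \<in> l2 I"
  using assms
proof (induction J)
  case (insert m J)
  then show ?case
    using l2_lincomb[of "f m" I "\<lambda>i. \<Sum>n\<in>J. f n i" 1 1] by simp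
qed (simp add: l2_zero)

lemma bounded_ops_sum_arg:
  assumes "T \<in> bounded_ops I" "finite J" "\<And>n. n \<in> J \<Longrightarrow> f n \<in> l2 I"
  shows "T (\<lambda>i. \<Sum>n\<in>J. f n i) = (\<lambda>i. \<Sum>n\<in>J. T (f n) i)"
  using assms(2,3)
proof (induction J)
  case empty
  then show ?case using bounded_ops_zero[OF assms(1)] by simp
next
  case (insert m J)
  then show ?case
    using bounded_ops_add[OF assms(1), of "f m" "\<lambda>i. \<Sum>n\<in>J. f n i"] by (simp add: l2_sum)
qed

lemma bounded_opsI:
  assumes "\<And>f. f \<in> l2 I \<Longrightarrow> T f \<in> l2 I" "\<And>f. f \<notin> l2 I \<Longrightarrow> T f = (\<lambda>_. 0)"
    and "\<And>f g a b. f \<in> l2 I \<Longrightarrow> g \<in> l2 I \<Longrightarrow> T (\<lambda>i. a * f i + b * g i) = (\<lambda>i. a * T f i + b * T g i)"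
    and "op_bound I C T"
  shows "T \<in> bounded_ops I"
  unfolding bounded_ops_def mem_Collect_eq using assms by (auto simp: op_bound_def)

lemma bounded_ops_obtain_bound:
  assumes "T \<in> bounded_ops I"
  obtains C where "0 \<le> C" "op_bound I C T"
proof -
  obtain C where C: "\<forall>f\<in>l2 I. l2_norm I (T f) \<le> C * l2_norm I f"
    using assms by (auto simp: bounded_ops_def)
  have "op_bound I \<bar>C\<bar> T"
    unfolding op_bound_def
  proof
    fix f assume "f \<in> l2 I"
    then have "l2_norm I (T f) \<le> C * l2_norm I f" using C by blast
    also have "\<dots> \<le> \<bar>C\<bar> * l2_norm I f" by (intro mult_right_mono l2_norm_nonneg) auto
    finally show "l2_norm I (T f) \<le> \<bar>C\<bar> * l2_norm I f" .
  qed
  then show ?thesis using that[of "\<bar>C\<bar>"] by simp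
qed

lemma l2_norm_triangle:
  assumes "f \<in> l2 I" "g \<in> l2 I"
  shows "l2_norm I (\<lambda>i. f i + g i) \<le> l2_norm I f + l2_norm I g"
proof (rule l2_finite_sum_bound(2))
  fix F assume F: "finite F" "F \<subseteq> I"
  have "(L2_set (\<lambda>i. cmod (f i + g i)) F) \<le> L2_set (\<lambda>i. cmod (f i) + cmod (g i)) F"
    by (intro L2_set_mono norm_triangle_ineq) auto
  also have "\<dots> \<le> L2_set (\<lambda>i. cmod (f i)) F + L2_set (\<lambda>i. cmod (g i)) F"
    by (rule L2_set_triangle_ineq)
  also have "\<dots> \<le> l2_norm I f + l2_norm I g"
    by (intro add_mono)
      (use l2_sum_le[OF assms(1) F] l2_sum_le[OF assms(2) F] in
        \<open>auto simp: L2_set_def l2_norm_nonneg intro!: real_le_lsqrt\<close>)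
  finally have "(L2_set (\<lambda>i. cmod (f i + g i)) F)\<^sup>2 \<le> (l2_norm I f + l2_norm I g)\<^sup>2"
    by (intro power_mono) auto
  then show "(\<Sum>i\<in>F. (cmod (f i + g i))\<^sup>2) \<le> (l2_norm I f + l2_norm I g)\<^sup>2"
    by (simp add: L2_set_def sum_nonneg)
qed (use assms in \<open>auto simp: l2_def l2_norm_nonneg\<close>)

lemma l2_norm_scale: "l2_norm I (\<lambda>i. c * f i) = cmod c * l2_norm I f"
  by (simp add: l2_norm_def norm_mult power_mult_distrib infsum_cmult_right' real_sqrt_mult)

section \<open>Algebraic operations on bounded operators\<close>

lemma bounded_ops_plus:
  assumes S: "S \<in> bounded_ops I" and T: "T \<in> bounded_ops I"
  shows "(\<lambda>f i. S f i + T f i) \<in> bounded_ops I"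
proof -
  obtain C D where C: "op_bound I C S" and D: "op_bound I D T"
    using bounded_ops_obtain_bound S T by metis
  have "op_bound I (C + D) (\<lambda>f i. S f i + T f i)"
    unfolding op_bound_def distrib_right
  proof
    fix f assume "f \<in> l2 I"
    then show "l2_norm I (\<lambda>i. S f i + T f i) \<le> C * l2_norm I f + D * l2_norm I f"
      using l2_norm_triangle[OF bounded_ops_l2[OF S] bounded_ops_l2[OF T], of f f] C D
      by (meson add_mono op_bound_def order_trans)
  qed
  moreover have "(\<lambda>i. S f i + T f i) \<in> l2 I" for f
    using l2_lincomb[OF bounded_ops_l2[OF S] bounded_ops_l2[OF T], of 1 f 1 f] by simp
  ultimately show ?thesis
    using S T by (intro bounded_opsI)
      (auto simp: bounded_ops_outside bounded_ops_lincomb algebra_simps)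
qed

lemma bounded_ops_smult:
  assumes T: "T \<in> bounded_ops I"
  shows "(\<lambda>f i. c * T f i) \<in> bounded_ops I"
proof -
  obtain D where D: "op_bound I D T"
    using bounded_ops_obtain_bound T by metis
  have "op_bound I (cmod c * D) (\<lambda>f i. c * T f i)"
    using D by (auto simp: op_bound_def l2_norm_scale mult.assoc intro!: mult_left_mono)
  moreover have "(\<lambda>i. c * T f i) \<in> l2 I" for f
    using l2_lincomb[OF bounded_ops_l2[OF T] bounded_ops_l2[OF T], of c f 0 f] by simp
  ultimately show ?thesis
    using T by (intro bounded_opsI)
      (auto simp: bounded_ops_outside bounded_ops_lincomb algebra_simps)
qed

lemma bounded_ops_comp:
  assumes S: "S \<in> bounded_ops I" and T: "T \<in> bounded_ops I"
  shows "S \<circ> T \<in> bounded_ops I"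
proof -
  obtain C D where C: "0 \<le> C" "op_bound I C S" and D: "op_bound I D T"
    using bounded_ops_obtain_bound S T by metis
  have "op_bound I (C * D) (S \<circ> T)"
    unfolding op_bound_def
  proof
    fix f assume f: "f \<in> l2 I"
    have "l2_norm I (S (T f)) \<le> C * l2_norm I (T f)"
      using C bounded_ops_l2[OF T] by (auto simp: op_bound_def)
    also have "\<dots> \<le> C * (D * l2_norm I f)"
      using C D f by (auto simp: op_bound_def intro!: mult_left_mono)
    finally show "l2_norm I ((S \<circ> T) f) \<le> C * D * l2_norm I f" by (simp add: mult.assoc)
  qed
  then show ?thesis
    using S T by (intro bounded_opsI)
      (auto simp: bounded_ops_outside bounded_ops_lincomb bounded_ops_l2 bounded_ops_zero)
qed

lemma id_op_bounded: "id_op I \<in> bounded_ops I"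
  by (rule bounded_opsI[where C = 1]) (auto simp: id_op_def l2_lincomb op_bound_def l2_zero)

lemma zero_op_bounded: "(\<lambda>_ _. 0) \<in> bounded_ops I"
  using bounded_ops_smult[OF id_op_bounded, of 0] by simp

lemma bounded_ops_sum:
  assumes "finite J" "\<And>n. n \<in> J \<Longrightarrow> T n \<in> bounded_ops I"
  shows "(\<lambda>f i. \<Sum>n\<in>J. c n * T n f i) \<in> bounded_ops I"
  using assms
proof (induction J)
  case (insert m J)
  then show ?case
    using bounded_ops_plus[OF bounded_ops_smult[of "T m" I "c m"]] by simp
qed (simp add: zero_op_bounded)

lemma unital_subalgebra_plus:
  "unital_subalgebra I S \<Longrightarrow> T \<in> S \<Longrightarrow> U \<in> S \<Longrightarrow> (\<lambda>f i. T f i + U f i) \<in> S"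
  by (simp add: unital_subalgebra_def)

lemma unital_subalgebra_smult:
  "unital_subalgebra I S \<Longrightarrow> T \<in> S \<Longrightarrow> (\<lambda>f i. c * T f i) \<in> S"
  by (simp add: unital_subalgebra_def)

lemma unital_subalgebra_sum:
  assumes S: "unital_subalgebra I S" and "finite J" "\<And>n. n \<in> J \<Longrightarrow> T n \<in> S"
  shows "(\<lambda>f i. \<Sum>n\<in>J. c n * T n f i) \<in> S"
  using assms(2,3)
proof (induction J)
  case empty
  have "id_op I \<in> S" using S by (simp add: unital_subalgebra_def)
  from unital_subalgebra_smult[OF S this, of 0] show ?case by simp
next
  case (insert m J)
  then show ?case
    using unital_subalgebra_plus[OF S unital_subalgebra_smult[OF S, of "T m" "c m"]] by simp
qed

section \<open>Compressions to matrix blocks and single rows\<close>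

definition compression where
  "compression I X Y T = (\<lambda>f. if f \<in> l2 I then restr X (T (restr Y f)) else (\<lambda>_. 0))"

lemma compression_bounded:
  assumes T: "T \<in> bounded_ops I" "0 \<le> C" "op_bound I C T"
  shows "compression I X Y T \<in> bounded_ops I" and "op_bound I C (compression I X Y T)"
proof -
  show b: "op_bound I C (compression I X Y T)"
    unfolding op_bound_def
  proof
    fix f assume f: "f \<in> l2 I"
    have "l2_norm I (compression I X Y T f) \<le> l2_norm I (T (restr Y f))"
      using f by (simp add: compression_def restr_l2 bounded_ops_l2[OF T(1)])
    also have "\<dots> \<le> C * l2_norm I (restr Y f)"
      using T restr_l2[OF f] by (simp add: op_bound_def)
    also have "\<dots> \<le> C * l2_norm I f"
      using T restr_l2[OF f] by (simp add: mult_left_mono)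
    finally show "l2_norm I (compression I X Y T f) \<le> C * l2_norm I f" .
  qed
  show "compression I X Y T \<in> bounded_ops I"
  proof (rule bounded_opsI[OF _ _ _ b])
    fix f g a b assume fg: "f \<in> l2 I" "g \<in> l2 I"
    have "restr Y (\<lambda>i. a * f i + b * g i) = (\<lambda>i. a * restr Y f i + b * restr Y g i)"
      by (auto simp: restr_def)
    then show "compression I X Y T (\<lambda>i. a * f i + b * g i)
        = (\<lambda>i. a * compression I X Y T f i + b * compression I X Y T g i)"
      using fg by (simp add: compression_def l2_lincomb bounded_ops_lincomb[OF T(1)] restr_l2)
        (auto simp: restr_def)
  qed (auto simp: compression_def restr_l2 bounded_ops_l2[OF T(1)])
qed

lemma compression_in_bounded_ops:
  "T \<in> bounded_ops I \<Longrightarrow> compression I X Y T \<in> bounded_ops I"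
  using compression_bounded(1) bounded_ops_obtain_bound by metis

lemma restr_ket: "restr Y (ket v) = (if v \<in> Y then ket v else (\<lambda>_. 0))"
  by (auto simp: restr_def ket_def)

lemma restr_UNIV [simp]: "restr UNIV f = f"
  by (simp add: restr_def)

text \<open>With the one-element row set \<open>{x}\<close>, an equality of compressions can be
  checked on basis vectors by \<open>bounded_ops_eqI\<close>; this lemma then reads it off as an
  identity for the coordinate \<open>x\<close> at an arbitrary vector \<open>h\<close>.\<close>

lemma compression_coord:
  assumes "compression I {x} X S = compression I {x} Y T" "h \<in> l2 I"
  shows "S (restr X h) x = T (restr Y h) x"
  using fun_cong[OF fun_cong[OF assms(1), of h], of x] assms(2)
  by (simp add: compression_def restr_def)

text \<open>Injectivity of \<open>c\<close> leaves row \<open>c w\<close> of the matrix only the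
  entry in column \<open>w\<close>, and rows outside the range of \<open>c\<close> are zero.
  Compressing to one row carries this from basis vectors to all \<open>h\<close>.\<close>

lemma weighted_shift_coord:
  assumes T: "T \<in> bounded_ops I" and c: "inj_on c W" and W: "W \<subseteq> I"
    and ket: "\<And>v. v \<in> I \<Longrightarrow> T (ket v) = (if v \<in> W then (\<lambda>u. a v * ket (c v) u) else (\<lambda>_. 0))"
    and h: "h \<in> l2 I"
  shows "w \<in> W \<Longrightarrow> T h (c w) = a w * h w" and "x \<notin> c ` W \<Longrightarrow> T h x = 0"
proof -
  assume w: "w \<in> W"
  have "compression I {c w} UNIV T = compression I {c w} {w} T"
  proof (rule bounded_ops_eqI)
    fix v assume v: "v \<in> I"
    have "restr {c w} (T (ket v)) = restr {c w} (T (restr {w} (ket v)))"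
    proof (cases "v = w")
      case False
      then have "ket (c v) (c w) = 0" if "v \<in> W"
        using inj_onD[OF c _ w that] that by (auto simp: ket_def)
      then show ?thesis
        using False ket[OF v] by (auto simp: restr_ket bounded_ops_zero[OF T]) (auto simp: restr_def)
    qed (simp add: restr_ket)
    then show "compression I {c w} UNIV T (ket v) = compression I {c w} {w} T (ket v)"
      by (simp add: compression_def)
  qed (simp_all add: compression_in_bounded_ops T)
  from compression_coord[OF this h] have "T h (c w) = T (restr {w} h) (c w)"
    by simp
  also have "restr {w} h = (\<lambda>i. h w * ket w i)"
    by (auto simp: restr_def ket_def)
  also have "T \<dots> (c w) = h w * T (ket w) (c w)"
    using w W by (subst bounded_ops_scale[OF T]) (auto intro: ket_in_l2)
  also have "\<dots> = a w * h w"
    using w W by (subst ket) (auto simp: ket_def)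
  finally show "T h (c w) = a w * h w" .
next
  assume x: "x \<notin> c ` W"
  have "compression I {x} UNIV T = compression I {x} {} T"
  proof (rule bounded_ops_eqI)
    fix v assume v: "v \<in> I"
    have "T (ket v) x = 0"
      using x by (subst ket[OF v]) (auto simp: ket_def)
    then show "compression I {x} UNIV T (ket v) = compression I {x} {} T (ket v)"
      by (auto simp: compression_def restr_ket bounded_ops_zero[OF T] restr_def fun_eq_iff)
  qed (simp_all add: compression_in_bounded_ops T zero_op_bounded)
  from compression_coord[OF this h] show "T h x = 0"
    by (simp add: restr_def bounded_ops_zero[OF T])
qed

section \<open>The weak operator topology\<close>

lemma l2_mult_finite_sum:
  assumes "f \<in> l2 I" "g \<in> l2 I" "finite F" "F \<subseteq> I"
  shows "(\<Sum>i\<in>F. cmod (f i * cnj (g i))) \<le> l2_norm I f * l2_norm I g"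
proof -
  have "(\<Sum>i\<in>F. cmod (f i * cnj (g i))) \<le> L2_set (\<lambda>i. cmod (f i)) F * L2_set (\<lambda>i. cmod (g i)) F"
    using L2_set_mult_ineq[of "\<lambda>i. cmod (f i)" "\<lambda>i. cmod (g i)" F] by (simp add: norm_mult)
  also have "\<dots> \<le> l2_norm I f * l2_norm I g"
    by (intro mult_mono)
      (use l2_sum_le[OF assms(1,3,4)] l2_sum_le[OF assms(2,3,4)] in
        \<open>auto simp: L2_set_def l2_norm_nonneg sum_nonneg intro!: real_le_lsqrt\<close>)
  finally show ?thesis .
qed

lemma l2_inner_abs_summable:
  assumes "f \<in> l2 I" "g \<in> l2 I"
  shows "(\<lambda>i. cmod (f i * cnj (g i))) summable_on I"
  using l2_mult_finite_sum[OF assms]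
  by (intro nonneg_bdd_above_summable_on) (auto intro!: bdd_aboveI[of _ "l2_norm I f * l2_norm I g"])

lemma l2_cauchy_schwarz:
  assumes "f \<in> l2 I" "g \<in> l2 I"
  shows "cmod (l2_inner I f g) \<le> l2_norm I f * l2_norm I g"
proof -
  have "cmod (l2_inner I f g) \<le> (\<Sum>\<^sub>\<infinity>i\<in>I. cmod (f i * cnj (g i)))"
    unfolding l2_inner_def by (rule norm_infsum_bound[OF l2_inner_abs_summable[OF assms]])
  also have "\<dots> \<le> l2_norm I f * l2_norm I g"
    by (rule infsum_le_finite_sums[OF l2_inner_abs_summable[OF assms]])
      (use l2_mult_finite_sum[OF assms] in auto)
  finally show ?thesis .
qed

lemma l2_inner_summable:
  assumes "f \<in> l2 I" "g \<in> l2 I"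
  shows "(\<lambda>i. f i * cnj (g i)) summable_on I"
  by (rule abs_summable_summable[OF l2_inner_abs_summable[OF assms]])

lemma l2_inner_ket:
  assumes "u \<in> I"
  shows "l2_inner I f (ket u) = f u"
proof -
  have "l2_inner I f (ket u) = (\<Sum>\<^sub>\<infinity>i\<in>{u}. f i * cnj (ket u i))"
    unfolding l2_inner_def by (rule infsum_cong_neutral) (use assms in \<open>auto simp: ket_def\<close>)
  then show ?thesis by (simp add: ket_def)
qed

lemma l2_inner_restr_finite:
  assumes "finite F" "F \<subseteq> I"
  shows "l2_inner I f (restr F g) = (\<Sum>i\<in>F. f i * cnj (g i))"
proof -
  have "l2_inner I f (restr F g) = (\<Sum>\<^sub>\<infinity>i\<in>F. f i * cnj (g i))"
    unfolding l2_inner_def by (rule infsum_cong_neutral) (use assms in \<open>auto simp: restr_def\<close>)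
  then show ?thesis using assms by simp
qed

lemma l2_inner_split:
  assumes "f \<in> l2 I" "g \<in> l2 I"
  shows "l2_inner I f g = l2_inner I f (restr F g) + l2_inner I f (restr (- F) g)"
proof -
  have "l2_inner I f (restr F g) + l2_inner I f (restr (- F) g)
      = (\<Sum>\<^sub>\<infinity>i\<in>I. f i * cnj (restr F g i) + f i * cnj (restr (- F) g i))"
    unfolding l2_inner_def
    by (rule infsum_add[symmetric]) (intro l2_inner_summable restr_l2 assms)+
  also have "\<dots> = l2_inner I f g"
    unfolding l2_inner_def by (rule infsum_cong) (simp add: restr_def)
  finally show ?thesis by simp
qed

text \<open>Split \<open>g\<close> into a part on a finite set \<open>F\<close> and a tail of small
  norm. On \<open>F\<close> only finitely many convergent coordinates matter; the tail is controlled
  by Cauchy-Schwarz and the uniform bound \<open>D\<close>. The filter is arbitrary because limits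
  are taken later both along sequences and along finite sets of paths.\<close>

lemma l2_weak_limit:
  assumes h: "\<And>x. h x \<in> l2 I" "\<And>x. l2_norm I (h x) \<le> D" and k: "k \<in> l2 I" "l2_norm I k \<le> D"
    and lim: "\<And>u. u \<in> I \<Longrightarrow> ((\<lambda>x. h x u) \<longlongrightarrow> k u) \<F>"
    and g: "g \<in> l2 I"
  shows "((\<lambda>x. l2_inner I (h x) g) \<longlongrightarrow> l2_inner I k g) \<F>"
proof (rule tendstoI)
  fix \<epsilon> :: real assume \<epsilon>: "\<epsilon> > 0"
  have D: "0 \<le> D" using k l2_norm_nonneg[of I k] by linarith
  \<comment> \<open>Chosen so that \<open>(D + 1) * \<delta>\<close> equals
    \<open>\<epsilon> / 4\<close>; the added 1 keeps the denominator positive when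
    \<open>D = 0\<close>.\<close>
  define \<delta> where "\<delta> = \<epsilon> / (4 * (D + 1))"
  have \<delta>: "\<delta> > 0" using \<epsilon> D by (simp add: \<delta>_def)
  obtain F where F: "finite F" "F \<subseteq> I"
    and le: "l2_norm I (\<lambda>i. 1 * g i + (-1) * (if i \<in> F then g i else 0)) \<le> \<delta>"
    using l2_approx[OF g \<delta>] by blast
  have "(\<lambda>i. 1 * g i + (-1) * (if i \<in> F then g i else 0)) = restr (- F) g"
    by (auto simp: restr_def)
  then have tail: "l2_norm I (restr (- F) g) \<le> \<delta>" using le by simp
  have small: "cmod (l2_inner I f (restr (- F) g)) \<le> \<epsilon> / 4" if "f \<in> l2 I" "l2_norm I f \<le> D" for f
  proof -
    have "cmod (l2_inner I f (restr (- F) g)) \<le> l2_norm I f * l2_norm I (restr (- F) g)"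
      by (rule l2_cauchy_schwarz) (use that g restr_l2 in auto)
    also have "\<dots> \<le> (D + 1) * \<delta>"
      using that tail \<delta> D by (intro mult_mono) (auto simp: l2_norm_nonneg)
    also have "\<dots> = \<epsilon> / 4" using D by (simp add: \<delta>_def divide_simps)
    finally show ?thesis .
  qed
  have "((\<lambda>x. \<Sum>i\<in>F. h x i * cnj (g i)) \<longlongrightarrow> (\<Sum>i\<in>F. k i * cnj (g i))) \<F>"
    using lim F by (intro tendsto_intros) auto
  then have "\<forall>\<^sub>F x in \<F>. dist (\<Sum>i\<in>F. h x i * cnj (g i)) (\<Sum>i\<in>F. k i * cnj (g i)) < \<epsilon> / 4"
    by (rule tendstoD) (use \<epsilon> in simp)
  then show "\<forall>\<^sub>F x in \<F>. dist (l2_inner I (h x) g) (l2_inner I k g) < \<epsilon>"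
  proof eventually_elim
    case (elim x)
    let ?a = "\<lambda>f. l2_inner I f (restr F g)" and ?b = "\<lambda>f. l2_inner I f (restr (- F) g)"
    have "dist (l2_inner I (h x) g) (l2_inner I k g) = cmod ((?a (h x) - ?a k) + (?b (h x) - ?b k))"
      using l2_inner_split[OF h(1)[of x] g, of F] l2_inner_split[OF k(1) g, of F]
      by (simp add: dist_norm algebra_simps)
    also have "\<dots> \<le> cmod (?a (h x) - ?a k) + (cmod (?b (h x)) + cmod (?b k))"
      by (rule order_trans[OF norm_triangle_ineq add_left_mono[OF norm_triangle_ineq4]])
    also have "\<dots> \<le> cmod (?a (h x) - ?a k) + (\<epsilon> / 4 + \<epsilon> / 4)"
      by (intro add_left_mono add_mono small h k)
    also have "\<dots> < \<epsilon> / 4 + (\<epsilon> / 4 + \<epsilon> / 4)"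
      using elim by (simp add: l2_inner_restr_finite[OF F] dist_norm)
    also have "\<dots> \<le> \<epsilon>"
      using \<epsilon> by simp
    finally show ?case .
  qed
qed

section \<open>Carrier, continuous coefficients and a convergence criterion\<close>

lemma topspace_wot: "topspace (wot I) = bounded_ops I"
proof -
  \<comment> \<open>The carrier is the union of the subbasis, and the choice \<open>U = UNIV\<close>
    makes all of \<open>bounded_ops I\<close> a subbasic set.\<close>
  have "bounded_ops I \<in> {{T \<in> bounded_ops I. l2_inner I (T f) g \<in> U} | f g U. f \<in> l2 I \<and> g \<in> l2 I \<and> open U}"
    by (rule CollectI, rule exI[of _ "\<lambda>_. 0"], rule exI[of _ "\<lambda>_. 0"], rule exI[of _ UNIV])
      (simp add: l2_zero)
  then show ?thesis
    unfolding wot_def topology_generated_by_topspace by blast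
qed

lemma continuous_map_wot_coeff:
  assumes "f \<in> l2 I" "g \<in> l2 I"
  shows "continuous_map (wot I) euclidean (\<lambda>T. l2_inner I (T f) g)"
  unfolding continuous_map_def topspace_wot
proof (intro conjI allI impI)
  fix U :: "complex set" assume "openin euclidean U"
  then show "openin (wot I) {T \<in> bounded_ops I. l2_inner I (T f) g \<in> U}"
    unfolding wot_def using assms by (intro topology_generated_by_Basis) auto
qed auto

text \<open>For a uniformly bounded family, coordinatewise convergence is enough. Induction on the
  generation of an open set reduces the claim to subbasic sets, where \<open>l2_weak_limit\<close>
  applies for each fixed \<open>f\<close> with bound \<open>C * l2_norm I f\<close>.\<close>

lemma limitin_wotI:
  assumes A: "A \<in> bounded_ops I" "op_bound I C A"
    and T: "\<And>x. T x \<in> bounded_ops I" "\<And>x. op_bound I C (T x)"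
    and lim: "\<And>f u. f \<in> l2 I \<Longrightarrow> u \<in> I \<Longrightarrow> ((\<lambda>x. T x f u) \<longlongrightarrow> A f u) \<F>"
  shows "limitin (wot I) T A \<F>"
  unfolding limitin_def topspace_wot
proof (intro conjI allI impI A(1))
  fix U assume U: "openin (wot I) U \<and> A \<in> U"
  then have "generate_topology_on
      {{T \<in> bounded_ops I. l2_inner I (T f) g \<in> U} | f g U. f \<in> l2 I \<and> g \<in> l2 I \<and> open U} U"
    unfolding wot_def by (simp add: openin_topology_generated_by_iff)
  \<comment> \<open>Membership of \<open>A\<close> stays inside the induction formula, since only
    those members of a union that contain \<open>A\<close> give information.\<close>
  then have "A \<in> U \<longrightarrow> (\<forall>\<^sub>F x in \<F>. T x \<in> U)"
  proof (induction rule: generate_topology_on.induct)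
    case (Int a b)
    then show ?case by (auto intro: eventually_conj)
  next
    case (UN K)
    show ?case
    proof
      assume "A \<in> \<Union> K"
      then obtain X where X: "X \<in> K" "A \<in> X" by blast
      with UN have "\<forall>\<^sub>F x in \<F>. T x \<in> X" by blast
      then show "\<forall>\<^sub>F x in \<F>. T x \<in> \<Union> K"
        by (rule eventually_mono) (use X in blast)
    qed
  next
    case (Basis s)
    then obtain f g V where s: "s = {T \<in> bounded_ops I. l2_inner I (T f) g \<in> V}"
      and fg: "f \<in> l2 I" "g \<in> l2 I" and V: "open V" by blast
    have "((\<lambda>x. l2_inner I (T x f) g) \<longlongrightarrow> l2_inner I (A f) g) \<F>"
      by (rule l2_weak_limit[where D = "C * l2_norm I f"])
        (use A T lim fg in \<open>auto simp: bounded_ops_l2 op_bound_def\<close>)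
    then show ?case
      using T(1) V by (auto simp: s dest: topological_tendstoD)
  qed auto
  then show "\<forall>\<^sub>F x in \<F>. T x \<in> U" using U by blast
qed

section \<open>Generated algebras and commutants\<close>

lemma unital_subalgebra_bounded_ops: "unital_subalgebra I (bounded_ops I)"
  by (auto simp: unital_subalgebra_def id_op_bounded bounded_ops_plus bounded_ops_smult
      bounded_ops_comp)

text \<open>The algebra of all bounded operators is itself a WOT-closed unital algebra containing
  \<open>X\<close>, so it takes part in the intersection that defines the hull.\<close>

lemma wot_algebra_generated_bounded:
  assumes "X \<subseteq> bounded_ops I"
  shows "wot_algebra_generated I X \<subseteq> bounded_ops I"
  unfolding wot_algebra_generated_def
  by (rule hull_minimal[OF assms])
    (use closedin_topspace[of "wot I"] in \<open>simp add: unital_subalgebra_bounded_ops topspace_wot\<close>)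

lemma subset_double_commutant: "X \<subseteq> bounded_ops I \<Longrightarrow> X \<subseteq> commutant I (commutant I X)"
  by (auto simp: commutant_def)

text \<open>\<open>row\<close> stands in for the adjoint of \<open>R\<close> in the proof that \<open>T \<mapsto> R T\<close> is WOT-continuous.\<close>

lemma closedin_wot_commutant_row:
  assumes R: "R \<in> bounded_ops I"
    and row: "\<And>u. u \<in> I \<Longrightarrow> \<exists>c. \<exists>w\<in>I. \<forall>h\<in>l2 I. R h u = c * h w"
  shows "closedin (wot I) (commutant I {R})"
proof -
  obtain c w where w: "\<And>u. u \<in> I \<Longrightarrow> w u \<in> I"
    and cw: "\<And>u h. u \<in> I \<Longrightarrow> h \<in> l2 I \<Longrightarrow> R h u = c u * h (w u)"
    using row by metis
  \<comment> \<open>\<open>D f u T\<close> is the coordinate \<open>u\<close> of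
    \<open>(TR - RT) f\<close>, written through inner products of \<open>T\<close> with fixed
    vectors so that its WOT-continuity in \<open>T\<close> is visible.\<close>
  define D where "D f u T = l2_inner I (T (R f)) (ket u) - c u * l2_inner I (T f) (ket (w u))" for f u T
  have D: "D f u T = T (R f) u - R (T f) u" if "u \<in> I" "T \<in> bounded_ops I" for f u T
    using that by (simp add: D_def l2_inner_ket w cw bounded_ops_l2)
  have comm: "T \<circ> R = R \<circ> T \<longleftrightarrow> (\<forall>f\<in>l2 I. \<forall>u\<in>I. D f u T = 0)" if T: "T \<in> bounded_ops I" for T
  proof
    assume *: "\<forall>f\<in>l2 I. \<forall>u\<in>I. D f u T = 0"
    show "T \<circ> R = R \<circ> T"
    proof (intro ext)
      fix f u
      show "(T \<circ> R) f u = (R \<circ> T) f u"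
      proof (cases "f \<in> l2 I \<and> u \<in> I")
        case True
        then have "D f u T = 0" using * by blast
        then show ?thesis using D[OF _ T, of u f] True by simp
      next
        case False
        then show ?thesis
          using bounded_ops_l2[OF T, of "R f"] bounded_ops_l2[OF R, of "T f"]
            bounded_ops_outside[OF T, of f] bounded_ops_outside[OF R, of f]
            bounded_ops_zero[OF T] bounded_ops_zero[OF R]
          by (cases "f \<in> l2 I") (auto simp: l2_def)
      qed
    qed
  qed (auto simp: D[OF _ T] fun_eq_iff)
  have cont: "continuous_map (wot I) euclidean (D f u)" if "f \<in> l2 I" "u \<in> I" for f u
    unfolding D_def
    using continuous_map_wot_coeff[of "R f" I "ket u"] continuous_map_wot_coeff[of f I "ket (w u)"]
      that bounded_ops_l2[OF R] w
    by (auto simp: continuous_map_atin ket_in_l2 intro!: tendsto_intros)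
  have "closedin (wot I) {T \<in> topspace (wot I). D f u T \<in> {0}}" if "f \<in> l2 I" "u \<in> I" for f u
    by (rule closedin_continuous_map_preimage[OF cont[OF that]]) simp
  \<comment> \<open>Intersecting with the carrier gives the right set also for empty
    \<open>I\<close>, when the family of conditions is empty.\<close>
  then have "closedin (wot I)
      (topspace (wot I) \<inter> (\<Inter>(f, u)\<in>l2 I \<times> I. {T \<in> topspace (wot I). D f u T \<in> {0}}))"
    using l2_zero[of I] by (cases "I = {}") (auto intro!: closedin_Int closedin_INT)
  also have "topspace (wot I) \<inter> (\<Inter>(f, u)\<in>l2 I \<times> I. {T \<in> topspace (wot I). D f u T \<in> {0}})
      = {T \<in> bounded_ops I. \<forall>f\<in>l2 I. \<forall>u\<in>I. D f u T = 0}"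
    by (auto simp: topspace_wot)
  also have "\<dots> = commutant I {R}"
    unfolding commutant_def using comm by auto
  finally show ?thesis .
qed

text \<open>Together with WOT-closedness this makes the commutant of \<open>R\<close> a competitor
  in the hull, so that commuting with generators suffices for commuting with the generated
  algebra.\<close>

lemma unital_subalgebra_commutant:
  assumes R: "R \<in> bounded_ops I"
  shows "unital_subalgebra I (commutant I {R})"
  unfolding unital_subalgebra_def
proof (intro conjI ballI allI)
  have "id_op I \<circ> R = R \<circ> id_op I"
    by (auto simp: id_op_def bounded_ops_l2[OF R] bounded_ops_outside[OF R] bounded_ops_zero[OF R])
  then show "id_op I \<in> commutant I {R}"
    by (simp add: commutant_def id_op_bounded)
next
  fix S T assume "S \<in> commutant I {R}" "T \<in> commutant I {R}"
  then have ST: "S \<in> bounded_ops I" "T \<in> bounded_ops I" "\<And>f. S (R f) = R (S f)" "\<And>f. T (R f) = R (T f)"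
    by (auto simp: commutant_def fun_eq_iff)
  then show "(\<lambda>f i. S f i + T f i) \<in> commutant I {R}" "S \<circ> T \<in> commutant I {R}"
    by (auto simp: commutant_def bounded_ops_plus bounded_ops_comp bounded_ops_add[OF R] bounded_ops_l2)
next
  fix c T assume "T \<in> commutant I {R}"
  then have "T \<in> bounded_ops I" "\<And>f. T (R f) = R (T f)"
    by (auto simp: commutant_def fun_eq_iff)
  then show "(\<lambda>f i. c * T f i) \<in> commutant I {R}"
    by (auto simp: commutant_def bounded_ops_smult bounded_ops_scale[OF R] bounded_ops_l2)
qed (auto simp: commutant_def)

section \<open>Homogeneous parts and Cesaro means\<close>

lemma has_sum_finite_sum:
  fixes f :: "'a \<Rightarrow> 'b \<Rightarrow> 'c::topological_comm_monoid_add"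
  assumes "finite M" "\<And>m. m \<in> M \<Longrightarrow> (f m has_sum s m) I"
  shows "((\<lambda>i. \<Sum>m\<in>M. f m i) has_sum (\<Sum>m\<in>M. s m)) I"
  using assms by (induction M) (auto intro: has_sum_add)

text \<open>The bound on \<open>A\<close> is applied to each piece \<open>restr (B m) f\<close>;
  since every index lies in at most \<open>K\<close> of the sets \<open>B m\<close>, the squared
  norms of the pieces add up to at most \<open>K\<close> times that of \<open>f\<close>. Homogeneous
  parts use \<open>K = 1\<close>, Cesaro windows of length \<open>k\<close> use
  \<open>K = k\<close>.\<close>

lemma band_sum_bound:
  assumes A: "op_bound I C A" "A \<in> bounded_ops I" "0 \<le> C" and f: "f \<in> l2 I"
    and M: "finite M" and K: "\<And>v. v \<in> I \<Longrightarrow> card {m \<in> M. v \<in> B m} \<le> K"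
    and F: "finite F" "F \<subseteq> I"
  shows "(\<Sum>u\<in>F. \<Sum>m\<in>M. (cmod (A (restr (B m) f) u))\<^sup>2) \<le> C\<^sup>2 * (real K * (l2_norm I f)\<^sup>2)"
proof -
  have sm: "(\<lambda>i. (cmod (restr X f i))\<^sup>2) summable_on I" for X
    using restr_l2(1)[OF f, of X] by (simp add: l2_def)
  have "(\<Sum>u\<in>F. \<Sum>m\<in>M. (cmod (A (restr (B m) f) u))\<^sup>2)
      = (\<Sum>m\<in>M. \<Sum>u\<in>F. (cmod (A (restr (B m) f) u))\<^sup>2)"
    by (rule sum.swap)
  also have "\<dots> \<le> (\<Sum>m\<in>M. (C * l2_norm I (restr (B m) f))\<^sup>2)"
  proof (rule sum_mono)
    fix m
    have "(\<Sum>u\<in>F. (cmod (A (restr (B m) f) u))\<^sup>2) \<le> (l2_norm I (A (restr (B m) f)))\<^sup>2"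
      by (rule l2_sum_le[OF bounded_ops_l2[OF A(2)] F])
    also have "\<dots> \<le> (C * l2_norm I (restr (B m) f))\<^sup>2"
      by (rule power_mono) (use A(1) restr_l2[OF f] in \<open>auto simp: op_bound_def l2_norm_nonneg\<close>)
    finally show "(\<Sum>u\<in>F. (cmod (A (restr (B m) f) u))\<^sup>2) \<le> (C * l2_norm I (restr (B m) f))\<^sup>2" .
  qed
  also have "\<dots> = C\<^sup>2 * (\<Sum>m\<in>M. (\<Sum>\<^sub>\<infinity>i\<in>I. (cmod (restr (B m) f i))\<^sup>2))"
    by (simp add: power_mult_distrib l2_norm_sq sum_distrib_left)
  also have "(\<Sum>m\<in>M. (\<Sum>\<^sub>\<infinity>i\<in>I. (cmod (restr (B m) f i))\<^sup>2))
      = (\<Sum>\<^sub>\<infinity>i\<in>I. \<Sum>m\<in>M. (cmod (restr (B m) f i))\<^sup>2)"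
    by (rule infsumI[OF has_sum_finite_sum[OF M has_sum_infsum[OF sm]], symmetric])
  also have "\<dots> \<le> (\<Sum>\<^sub>\<infinity>i\<in>I. real K * (cmod (f i))\<^sup>2)"
  proof (rule infsum_mono)
    show "(\<lambda>i. \<Sum>m\<in>M. (cmod (restr (B m) f i))\<^sup>2) summable_on I"
      by (rule has_sum_imp_summable[OF has_sum_finite_sum[OF M has_sum_infsum[OF sm]]])
    show "(\<lambda>i. real K * (cmod (f i))\<^sup>2) summable_on I"
      using f by (intro summable_on_cmult_right) (auto simp: l2_def)
    fix i assume i: "i \<in> I"
    have "(\<Sum>m\<in>M. (cmod (restr (B m) f i))\<^sup>2) = (\<Sum>m\<in>M. if i \<in> B m then (cmod (f i))\<^sup>2 else 0)"
      by (rule sum.cong) (auto simp: restr_def)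
    also have "\<dots> = real (card {m \<in> M. i \<in> B m}) * (cmod (f i))\<^sup>2"
      using M by (simp add: sum.inter_filter[symmetric])
    also have "\<dots> \<le> real K * (cmod (f i))\<^sup>2"
      using K[OF i] by (intro mult_right_mono) auto
    finally show "(\<Sum>m\<in>M. (cmod (restr (B m) f i))\<^sup>2) \<le> real K * (cmod (f i))\<^sup>2" .
  qed
  also have "\<dots> = real K * (l2_norm I f)\<^sup>2"
    by (simp add: infsum_cmult_right' l2_norm_sq)
  finally show ?thesis by (simp add: mult_left_mono)
qed

definition level :: "('i \<Rightarrow> nat) \<Rightarrow> nat \<Rightarrow> 'i set" where
  "level len n = {v. len v = n}"

text \<open>Keeps the matrix entries whose row length exceeds the column length by exactly
  \<open>j\<close>. The guard \<open>j \<le> len u\<close> is essential: truncated subtraction would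
  otherwise select level 0.\<close>

definition homogeneous_part ::
    "'i set \<Rightarrow> ('i \<Rightarrow> nat) \<Rightarrow> nat \<Rightarrow> (('i \<Rightarrow> complex) \<Rightarrow> 'i \<Rightarrow> complex) \<Rightarrow> ('i \<Rightarrow> complex) \<Rightarrow> 'i \<Rightarrow> complex"
  where "homogeneous_part I len j A = (\<lambda>f u.
    if f \<in> l2 I \<and> j \<le> len u then A (restr (level len (len u - j)) f) u else 0)"

text \<open>Different output levels draw on disjoint input levels, so the pieces of \<open>f\<close>
  that enter are orthogonal and the bound \<open>C\<close> of \<open>A\<close> is not
  increased.\<close>

lemma homogeneous_part_bounded:
  assumes A: "op_bound I C A" "A \<in> bounded_ops I" "0 \<le> C"
  shows "homogeneous_part I len j A \<in> bounded_ops I" and "op_bound I C (homogeneous_part I len j A)"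
proof -
  let ?H = "homogeneous_part I len j A"
  have *: "?H f \<in> l2 I" "l2_norm I (?H f) \<le> C * l2_norm I f" if f: "f \<in> l2 I" for f
  proof -
    have "(\<Sum>u\<in>F. (cmod (?H f u))\<^sup>2) \<le> (C * l2_norm I f)\<^sup>2" if F: "finite F" "F \<subseteq> I" for F
    proof -
      \<comment> \<open>The finitely many input levels seen by \<open>F\<close>; a spurious level 0
        from truncated subtraction is harmless, as it only adds nonnegative terms.\<close>
      let ?M = "(\<lambda>u. len u - j) ` F"
      have "(\<Sum>u\<in>F. (cmod (?H f u))\<^sup>2) \<le> (\<Sum>u\<in>F. \<Sum>m\<in>?M. (cmod (A (restr (level len m) f) u))\<^sup>2)"
      proof (rule sum_mono)
        fix u assume u: "u \<in> F"
        have "(cmod (?H f u))\<^sup>2 \<le> (cmod (A (restr (level len (len u - j)) f) u))\<^sup>2"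
          by (simp add: homogeneous_part_def)
        also have "\<dots> \<le> (\<Sum>m\<in>?M. (cmod (A (restr (level len m) f) u))\<^sup>2)"
          using F u by (intro member_le_sum) auto
        finally show "(cmod (?H f u))\<^sup>2 \<le> (\<Sum>m\<in>?M. (cmod (A (restr (level len m) f) u))\<^sup>2)" .
      qed
      also have "\<dots> \<le> C\<^sup>2 * (real 1 * (l2_norm I f)\<^sup>2)"
      proof (rule band_sum_bound[OF A f _ _ F])
        fix v
        have "{m \<in> ?M. v \<in> level len m} \<subseteq> {len v}" by (auto simp: level_def)
        then show "card {m \<in> ?M. v \<in> level len m} \<le> 1"
          using card_mono[of "{len v}"] by fastforce
      qed (use F in auto)
      finally show ?thesis by (simp add: power_mult_distrib)
    qed
    note b = l2_finite_sum_bound[OF _ _ this]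
    have "?H f i = 0" if "i \<notin> I" for i
      using bounded_ops_l2[OF A(2)] that by (auto simp: homogeneous_part_def l2_def)
    then show "?H f \<in> l2 I" "l2_norm I (?H f) \<le> C * l2_norm I f"
      using b A(3) by (auto simp: l2_norm_nonneg)
  qed
  show b: "op_bound I C ?H"
    using * by (simp add: op_bound_def)
  show "?H \<in> bounded_ops I"
  proof (rule bounded_opsI[OF _ _ _ b])
    fix f g a b assume fg: "f \<in> l2 I" "g \<in> l2 I"
    have "restr X (\<lambda>i. a * f i + b * g i) = (\<lambda>i. a * restr X f i + b * restr X g i)" for X
      by (auto simp: restr_def)
    then show "?H (\<lambda>i. a * f i + b * g i) = (\<lambda>i. a * ?H f i + b * ?H g i)"
      using fg unfolding homogeneous_part_def
      by (simp only: bounded_ops_lincomb[OF A(2)] restr_l2) (auto simp: l2_lincomb)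
  qed (use * in \<open>auto simp: homogeneous_part_def\<close>)
qed

section \<open>Lower triangular operators and their Cesaro means\<close>

definition lower_triangular ::
    "'i set \<Rightarrow> ('i \<Rightarrow> nat) \<Rightarrow> (('i \<Rightarrow> complex) \<Rightarrow> 'i \<Rightarrow> complex) \<Rightarrow> bool" where
  "lower_triangular I len A \<longleftrightarrow> (\<forall>v\<in>I. \<forall>u. len u < len v \<longrightarrow> A (ket v) u = 0)"

text \<open>As \<open>X\<close> may be infinite, linearity alone does not give this. The row
  \<open>u\<close> compressed to the columns in \<open>X\<close> vanishes on basis vectors, hence
  everywhere by boundedness.\<close>

lemma lower_triangular_tail:
  assumes A: "A \<in> bounded_ops I" "lower_triangular I len A" and f: "f \<in> l2 I"
    and X: "\<And>v. v \<in> X \<Longrightarrow> len u < len v"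
  shows "A (restr X f) u = 0"
proof -
  have "compression I {u} X A = compression I {u} {} A"
  proof (rule bounded_ops_eqI)
    fix v assume v: "v \<in> I"
    have "A (restr X (ket v)) u = 0"
      using A(2) v X[of v] by (auto simp: restr_ket bounded_ops_zero[OF A(1)] lower_triangular_def)
    then show "compression I {u} X A (ket v) = compression I {u} {} A (ket v)"
      by (auto simp: compression_def restr_ket bounded_ops_zero[OF A(1)] fun_eq_iff)
        (auto simp: restr_def)
  qed (simp_all add: compression_in_bounded_ops A)
  from compression_coord[OF this f] show ?thesis
    by (simp add: restr_def bounded_ops_zero[OF A(1)])
qed

text \<open>Levels above \<open>len u\<close> do not reach the coordinate \<open>u\<close>, so the
  decomposition of the argument into levels becomes a finite sum. The predicate \<open>P\<close> is
  later either a window of levels or always true.\<close>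

lemma lower_triangular_expand:
  assumes A: "A \<in> bounded_ops I" "lower_triangular I len A" and f: "f \<in> l2 I"
  shows "A (restr {v. P (len v)} f) u = (\<Sum>n\<in>{n. n \<le> len u \<and> P n}. A (restr (level len n) f) u)"
proof -
  let ?J = "{n. n \<le> len u \<and> P n}" and ?X = "{v. len u < len v \<and> P (len v)}"
  have l: "restr Y f \<in> l2 I" for Y by (rule restr_l2[OF f])
  have fin: "finite ?J" by simp
  have "restr {v. P (len v)} f v = (\<Sum>n\<in>?J. restr (level len n) f v) + restr ?X f v" for v
  proof -
    have "(\<Sum>n\<in>?J. restr (level len n) f v) = (\<Sum>n\<in>?J. if n = len v then f v else 0)"
      by (rule sum.cong) (auto simp: restr_def level_def)
    also have "\<dots> = (if len v \<in> ?J then f v else 0)"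
      using fin by (subst sum.delta) auto
    finally show ?thesis by (auto simp: restr_def)
  qed
  then have "restr {v. P (len v)} f = (\<lambda>v. (\<Sum>n\<in>?J. restr (level len n) f v) + restr ?X f v)"
    by blast
  then have "A (restr {v. P (len v)} f) u = A (\<lambda>v. \<Sum>n\<in>?J. restr (level len n) f v) u + A (restr ?X f) u"
    using bounded_ops_add[OF A(1) l2_sum[OF fin l] l[of ?X]] by simp
  moreover have "A (restr ?X f) u = 0"
    by (rule lower_triangular_tail[OF A f]) auto
  ultimately show ?thesis
    using bounded_ops_sum_arg[OF A(1) fin l] by simp
qed

definition cesaro_mean ::
    "'i set \<Rightarrow> ('i \<Rightarrow> nat) \<Rightarrow> nat \<Rightarrow> (('i \<Rightarrow> complex) \<Rightarrow> 'i \<Rightarrow> complex) \<Rightarrow> ('i \<Rightarrow> complex) \<Rightarrow> 'i \<Rightarrow> complex"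
  where "cesaro_mean I len k A = (\<lambda>f u.
    \<Sum>j<k. of_real (1 - real j / real k) * homogeneous_part I len j A f u)"

text \<open>The Fejer weight \<open>(1 - j/k)\<close> counts the windows of length \<open>k\<close> which contain two levels at
  distance \<open>j\<close>; hence the Cesaro mean is an average of compressions of \<open>A\<close> to such windows.\<close>

lemma cesaro_mean_windows:
  assumes A: "A \<in> bounded_ops I" "lower_triangular I len A" and f: "f \<in> l2 I" and k: "0 < k"
  shows "cesaro_mean I len k A f u =
    (\<Sum>m\<in>{len u<..len u + k}. A (restr {v. len v < m \<and> m \<le> len v + k} f) u) / of_nat k"
proof -
  let ?N = "len u" and ?x = "\<lambda>n. A (restr (level len n) f) u"
  have "(\<Sum>m\<in>{?N<..?N + k}. A (restr {v. len v < m \<and> m \<le> len v + k} f) u)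
      = (\<Sum>m\<in>{?N<..?N + k}. \<Sum>n\<in>{n. n \<le> ?N \<and> (n < m \<and> m \<le> n + k)}. ?x n)"
    by (rule sum.cong[OF refl]) (rule lower_triangular_expand[OF A f])
  also have "\<dots> = (\<Sum>m\<in>{?N<..?N + k}. \<Sum>n\<in>{..?N}. if m \<le> n + k then ?x n else 0)"
  proof (rule sum.cong[OF refl])
    fix m assume "m \<in> {?N<..?N + k}"
    then have "{n. n \<le> ?N \<and> (n < m \<and> m \<le> n + k)} = {n \<in> {..?N}. m \<le> n + k}" by auto
    then show "(\<Sum>n\<in>{n. n \<le> ?N \<and> (n < m \<and> m \<le> n + k)}. ?x n) = (\<Sum>n\<in>{..?N}. if m \<le> n + k then ?x n else 0)"
      by (simp only: sum.inter_filter finite_atMost)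
  qed
  also have "\<dots> = (\<Sum>n\<in>{..?N}. \<Sum>m\<in>{?N<..?N + k}. if m \<le> n + k then ?x n else 0)"
    by (rule sum.swap)
  \<comment> \<open>Level \<open>n\<close> shares exactly the windows \<open>m\<close> in
    \<open>{?N<..n + k}\<close> with level \<open>?N\<close>; truncated subtraction correctly counts
    0 if there are none. With \<open>n = ?N - j\<close> the count becomes
    \<open>k - j\<close>.\<close>
  also have "\<dots> = (\<Sum>n\<in>{..?N}. of_nat (n + k - ?N) * ?x n)"
  proof (rule sum.cong[OF refl])
    fix n assume n: "n \<in> {..?N}"
    have "{m \<in> {?N<..?N + k}. m \<le> n + k} = {?N<..n + k}" using n by auto
    then show "(\<Sum>m\<in>{?N<..?N + k}. if m \<le> n + k then ?x n else 0) = of_nat (n + k - ?N) * ?x n"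
      by (simp add: sum.inter_filter[symmetric])
  qed
  also have "\<dots> = (\<Sum>j\<in>{..?N}. of_nat (k - j) * ?x (?N - j))"
    by (rule sum.reindex_bij_witness[where i = "\<lambda>j. ?N - j" and j = "\<lambda>n. ?N - n"])
      (auto intro!: arg_cong[of _ _ of_nat])
  \<comment> \<open>The two ranges differ only in zero terms: \<open>k - j\<close> is 0 for
    \<open>j \<ge> k\<close>, and the homogeneous part is 0 at \<open>u\<close> for
    \<open>j > ?N\<close>.\<close>
  also have "\<dots> = (\<Sum>j\<in>{..<k}. of_nat (k - j) * homogeneous_part I len j A f u)"
    by (rule sum.mono_neutral_cong) (use f in \<open>auto simp: homogeneous_part_def\<close>)
  also have "\<dots> / of_nat k = cesaro_mean I len k A f u"
    unfolding cesaro_mean_def sum_divide_distrib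
    by (rule sum.cong) (use k in \<open>auto simp: of_nat_diff field_simps\<close>)
  finally show ?thesis by simp
qed

text \<open>Squaring a sum over \<open>k\<close> windows costs a factor \<open>k\<close> by
  Cauchy-Schwarz, and the overlap of the windows costs another \<open>k\<close> through
  \<open>band_sum_bound\<close>. Both cancel against the squared average \<open>1/k\<close>, leaving
  the bound \<open>C\<close> for every \<open>k\<close>.\<close>

lemma cesaro_mean_bounded:
  assumes A: "op_bound I C A" "A \<in> bounded_ops I" "0 \<le> C" and tri: "lower_triangular I len A"
    and k: "0 < k"
  shows "cesaro_mean I len k A \<in> bounded_ops I" and "op_bound I C (cesaro_mean I len k A)"
proof -
  let ?S = "cesaro_mean I len k A" and ?B = "\<lambda>m. {v. len v < m \<and> m \<le> len v + k}"
  show S: "?S \<in> bounded_ops I"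
    unfolding cesaro_mean_def
    by (intro bounded_ops_sum homogeneous_part_bounded[OF A]) auto
  show "op_bound I C ?S"
    unfolding op_bound_def
  proof (intro ballI l2_finite_sum_bound(2))
    fix f assume f: "f \<in> l2 I"
    show "?S f i = 0" if "i \<notin> I" for i
      using bounded_ops_l2[OF S, of f] that by (simp add: l2_def)
    show "0 \<le> C * l2_norm I f" using A(3) by (simp add: l2_norm_nonneg)
    fix F assume F: "finite F" "F \<subseteq> I"
    \<comment> \<open>One finite range of window positions that serves every \<open>u\<close> in
      \<open>F\<close>; the sum of the lengths is a convenient upper bound for each of them.\<close>
    define M where "M = {..(\<Sum>u\<in>F. len u) + k}"
    have "(\<Sum>u\<in>F. (cmod (?S f u))\<^sup>2) \<le> (\<Sum>u\<in>F. (\<Sum>m\<in>M. (cmod (A (restr (?B m) f) u))\<^sup>2) / real k)"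
    proof (rule sum_mono)
      fix u assume u: "u \<in> F"
      let ?W = "{len u<..len u + k}"
      have "len u \<le> (\<Sum>u\<in>F. len u)" using F u by (intro member_le_sum) auto
      then have W: "?W \<subseteq> M" by (auto simp: M_def)
      have "(cmod (\<Sum>m\<in>?W. A (restr (?B m) f) u))\<^sup>2 \<le> (\<Sum>m\<in>?W. cmod (A (restr (?B m) f) u))\<^sup>2"
        by (intro power_mono norm_sum) auto
      also have "\<dots> \<le> real k * (\<Sum>m\<in>?W. (cmod (A (restr (?B m) f) u))\<^sup>2)"
        using sum_squared_le_sum_of_squares[of "\<lambda>m. cmod (A (restr (?B m) f) u)" ?W] by (simp add: mult.commute)
      also have "\<dots> \<le> real k * (\<Sum>m\<in>M. (cmod (A (restr (?B m) f) u))\<^sup>2)"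
        using W by (intro mult_left_mono sum_mono2) (auto simp: M_def)
      finally have "(cmod (\<Sum>m\<in>?W. A (restr (?B m) f) u))\<^sup>2 / (real k)\<^sup>2
          \<le> real k * (\<Sum>m\<in>M. (cmod (A (restr (?B m) f) u))\<^sup>2) / (real k)\<^sup>2"
        by (rule divide_right_mono) simp
      then show "(cmod (?S f u))\<^sup>2 \<le> (\<Sum>m\<in>M. (cmod (A (restr (?B m) f) u))\<^sup>2) / real k"
        using k by (simp add: cesaro_mean_windows[OF A(2) tri f k] norm_divide power_divide power2_eq_square)
    qed
    also have "\<dots> = (\<Sum>u\<in>F. \<Sum>m\<in>M. (cmod (A (restr (?B m) f) u))\<^sup>2) / real k"
      by (simp add: sum_divide_distrib)
    also have "\<dots> \<le> (C\<^sup>2 * (real k * (l2_norm I f)\<^sup>2)) / real k"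
    proof (intro divide_right_mono band_sum_bound[OF A f _ _ F])
      fix v
      have "{m \<in> M. v \<in> ?B m} \<subseteq> {len v<..len v + k}" by auto
      from card_mono[OF _ this] show "card {m \<in> M. v \<in> ?B m} \<le> k" by simp
    qed (simp_all add: M_def)
    also have "\<dots> = (C * l2_norm I f)\<^sup>2" using k by (simp add: power_mult_distrib)
    finally show "(\<Sum>u\<in>F. (cmod (?S f u))\<^sup>2) \<le> (C * l2_norm I f)\<^sup>2" .
  qed
qed

text \<open>At a fixed coordinate \<open>u\<close> only the degrees up to \<open>len u\<close>
  contribute, so this is a limit of a finite sum whose weights tend to 1.\<close>

lemma cesaro_mean_tendsto:
  assumes A: "A \<in> bounded_ops I" "lower_triangular I len A" and f: "f \<in> l2 I"
  shows "((\<lambda>k. cesaro_mean I len (Suc k) A f u) \<longlongrightarrow> A f u) sequentially"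
proof -
  let ?N = "len u" and ?H = "\<lambda>j. homogeneous_part I len j A f u"
  have "A f u = (\<Sum>n\<in>{n. n \<le> ?N \<and> True}. A (restr (level len n) f) u)"
    using lower_triangular_expand[OF A f, of "\<lambda>_. True" u] by (simp add: restr_def)
  also have "\<dots> = (\<Sum>j\<le>?N. ?H j)"
    by (rule sum.reindex_bij_witness[where i = "\<lambda>j. ?N - j" and j = "\<lambda>n. ?N - n"])
      (use f in \<open>auto simp: homogeneous_part_def\<close>)
  finally have Af: "A f u = (\<Sum>j\<le>?N. ?H j)" .
  have "(\<lambda>k. of_real (1 - real j * inverse (real (Suc k))) :: complex) \<longlonglongrightarrow> of_real (1 - real j * 0)" for j
    by (intro tendsto_intros LIMSEQ_inverse_real_of_nat)
  then have "(\<lambda>k. \<Sum>j\<le>?N. of_real (1 - real j * inverse (real (Suc k))) * ?H j)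
      \<longlonglongrightarrow> (\<Sum>j\<le>?N. of_real (1 - real j * 0) * ?H j)"
    by (intro tendsto_sum tendsto_mult tendsto_const)
  \<comment> \<open>From \<open>k \<ge> len u\<close> on, the range \<open>j < Suc k\<close>
    contains all contributing degrees and the further terms vanish at \<open>u\<close>.\<close>
  moreover have "\<forall>\<^sub>F k in sequentially.
      (\<Sum>j\<le>?N. of_real (1 - real j * inverse (real (Suc k))) * ?H j) = cesaro_mean I len (Suc k) A f u"
    using eventually_ge_at_top[of ?N]
  proof eventually_elim
    case (elim k)
    show ?case
      unfolding cesaro_mean_def
      by (rule sum.mono_neutral_cong_left) (use elim in \<open>auto simp: homogeneous_part_def divide_inverse\<close>)
  qed
  ultimately show ?thesis
    unfolding Af by (simp add: tendsto_cong)
qed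

text \<open>Partial sums of the degree expansion need not be uniformly bounded; Cesaro means are, so
  their coordinatewise convergence is WOT convergence.\<close>

lemma wot_closed_memI_homogeneous_parts:
  assumes A: "A \<in> bounded_ops I" "lower_triangular I len A"
    and S: "unital_subalgebra I S" "closedin (wot I) S"
    and H: "\<And>j. homogeneous_part I len j A \<in> S"
  shows "A \<in> S"
proof -
  obtain C where C: "0 \<le> C" "op_bound I C A" using bounded_ops_obtain_bound[OF A(1)] .
  have "limitin (wot I) (\<lambda>k. cesaro_mean I len (Suc k) A) A sequentially"
    by (rule limitin_wotI[OF A(1) C(2)])
      (use cesaro_mean_bounded[OF C(2) A(1) C(1) A(2)] cesaro_mean_tendsto[OF A] in auto)
  moreover have "cesaro_mean I len (Suc k) A \<in> S" for k
    unfolding cesaro_mean_def by (intro unital_subalgebra_sum[OF S(1)] H) auto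
  ultimately show ?thesis
    using S(2) by (intro limitin_closedin[of "wot I" _ A sequentially S]) auto
qed

section \<open>Creation operators on the path space\<close>

definition path_len :: "('v, 'e) gpath \<Rightarrow> nat" where
  "path_len w = length (snd w)"

lemma path_len_comp: "path_len (path_comp w v) = path_len w + path_len v"
  by (simp add: path_len_def path_comp_def)

lemma path_comp_assoc: "path_comp (path_comp w v) u = path_comp w (path_comp v u)"
  by (simp add: path_comp_def)

context wf_digraph
begin

lemma paths_iff: "w \<in> paths G \<longleftrightarrow> awalk (fst w) (snd w) (path_rng G w)"
  by (auto simp: paths_def path_rng_def)

lemma path_rng_vertex: "path_rng G (vertex_path x) = x"
  by (simp add: path_rng_def vertex_path_def)

lemma vertex_path_rng_in_paths: "v \<in> paths G \<Longrightarrow> vertex_path (path_rng G v) \<in> paths G"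
  unfolding paths_iff path_rng_vertex
  by (auto simp: vertex_path_def awalk_Nil_iff dest: awalk_last_in_verts)

lemma composable_vertex_left:
  assumes "v \<in> paths G"
  shows "composable G (vertex_path (path_rng G v)) v"
    and "path_comp (vertex_path (path_rng G v)) v = v"
  using assms vertex_path_rng_in_paths
  by (auto simp: composable_def path_src_def vertex_path_def path_comp_def)

lemma composable_vertex_right:
  assumes "composable G w v"
  shows "composable G w (vertex_path (path_rng G v))"
    and "path_comp w (vertex_path (path_rng G v)) = w"
  using assms vertex_path_rng_in_paths[of v] path_rng_vertex
  by (auto simp: composable_def path_src_def path_comp_def prod_eq_iff vertex_path_def)

lemma path_rng_comp:
  assumes "composable G w v"
  shows "path_rng G (path_comp w v) = path_rng G w"
  using assms by (auto simp: composable_def paths_iff path_comp_def path_src_def path_rng_def awalk_appendI)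

lemma path_comp_in: "composable G w v \<Longrightarrow> path_comp w v \<in> paths G"
  by (rule path_comp_in_paths[OF wf_digraph_axioms])

lemma composable_comp_right:
  "composable G v u \<Longrightarrow> composable G w (path_comp v u) \<longleftrightarrow> composable G w v"
  using path_comp_in[of v u] path_rng_comp[of v u] by (auto simp: composable_def)

lemma composable_comp_left:
  "composable G w v \<Longrightarrow> composable G (path_comp w v) u \<longleftrightarrow> composable G v u"
  using path_comp_in[of w v] by (auto simp: composable_def path_src_def path_comp_def)

text \<open>Recovers \<open>w\<close> of length \<open>j\<close> from \<open>u = wv\<close>. Arcs
  are listed in order of traversal, so the left factor is the end of the list, and its source is the
  range of the initial part cut off.\<close>

definition final_segment :: "nat \<Rightarrow> ('a, 'b) gpath \<Rightarrow> ('a, 'b) gpath" where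
  "final_segment j u = (path_rng G (fst u, take (path_len u - j) (snd u)), drop (path_len u - j) (snd u))"

lemma final_segment_comp: "composable G w v \<Longrightarrow> final_segment (path_len w) (path_comp w v) = w"
  by (auto simp: final_segment_def path_comp_def path_len_def composable_def path_src_def prod_eq_iff)

lemma final_segment_in_paths:
  assumes "u \<in> paths G" "j \<le> path_len u"
  shows "final_segment j u \<in> paths G" and "path_len (final_segment j u) = j"
proof -
  let ?n = "path_len u - j"
  have "awalk (fst u) (take ?n (snd u) @ drop ?n (snd u)) (path_rng G u)"
    using assms(1) by (simp add: paths_iff)
  then have "awalk (awlast (fst u) (take ?n (snd u))) (drop ?n (snd u)) (path_rng G u)"
    by (simp only: awalk_append_iff)
  then show "final_segment j u \<in> paths G"
    by (auto simp: final_segment_def paths_def path_rng_def)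
  show "path_len (final_segment j u) = j"
    using assms(2) by (simp add: final_segment_def path_len_def)
qed

section \<open>Left and right creation operators and their commutation\<close>

lemma left_op_in_bounded_ops:
  assumes "left_weight G l" "left_bounded G l" "w \<in> paths G"
  shows "left_op G l w \<in> bounded_ops (paths G)"
    and "v \<in> paths G \<Longrightarrow> left_op G l w (ket v) =
        (if composable G w v then (\<lambda>u. complex_of_real (l v w) * ket (path_comp w v) u) else (\<lambda>_. 0))"
proof -
  have "weight_sup G l w < \<infinity>"
    using assms by (simp add: left_bounded_def)
  note theI'[OF ex1_left_op[OF wf_digraph_axioms assms(1,3) this], folded left_op_def]
  then show "left_op G l w \<in> bounded_ops (paths G)"
    and "v \<in> paths G \<Longrightarrow> left_op G l w (ket v) =
        (if composable G w v then (\<lambda>u. complex_of_real (l v w) * ket (path_comp w v) u) else (\<lambda>_. 0))"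
    by blast+
qed

text \<open>A relation instead of a definite description: existence of some such operator is all
  that has to be shown.\<close>

definition right_op_for ::
    "('a, 'b) weight \<Rightarrow> ('a, 'b) gpath \<Rightarrow> ((('a, 'b) gpath \<Rightarrow> complex) \<Rightarrow> ('a, 'b) gpath \<Rightarrow> complex) \<Rightarrow> bool"
  where "right_op_for r u R \<longleftrightarrow> R \<in> bounded_ops (paths G) \<and>
    (\<forall>v\<in>paths G. R (ket v) =
      (if composable G v u then (\<lambda>x. complex_of_real (r v u) * ket (path_comp v u) x) else (\<lambda>_. 0)))"

text \<open>The product stores only the source of \<open>u\<close>; the source of \<open>v\<close>
  is recovered from composability, as the range of \<open>u\<close>.\<close>

lemma inj_on_comp_right: "inj_on (\<lambda>v. path_comp v u) {v. composable G v u}"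
  by (auto simp: inj_on_def path_comp_def composable_def path_src_def prod_eq_iff)

lemma right_op_exists:
  assumes r: "right_weight G r" "right_bounded G r" and u: "u \<in> paths G"
  obtains R where "right_op_for r u R"
proof -
  let ?W = "{v. composable G v u}"
  have le: "r v u \<le> enn2real (weight_sup G r u)" if "v \<in> paths G" for v
  proof -
    have "ennreal (r v u) \<le> weight_sup G r u"
      unfolding weight_sup_def using that by (rule SUP_upper)
    also have "\<dots> = ennreal (enn2real (weight_sup G r u))"
      using r(2) u by (simp add: right_bounded_def)
    finally show ?thesis by simp
  qed
  have W: "?W \<subseteq> paths G" by (auto simp: composable_def)
  have c: "(\<lambda>v. path_comp v u) ` ?W \<subseteq> paths G"
    by (intro image_subsetI path_comp_in) simp
  have "\<exists>T\<in>bounded_ops (paths G). \<forall>v\<in>paths G. T (ket v) =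
      (if v \<in> ?W then (\<lambda>x. complex_of_real (r v u) * ket (path_comp v u) x) else (\<lambda>_. 0))"
    by (rule weighted_shift_exists[OF inj_on_comp_right c W, where C = "enn2real (weight_sup G r u)"])
      (use r(1) u le in \<open>auto simp: right_weight_def composable_def\<close>)
  then show thesis using that by (auto simp: right_op_for_def)
qed

text \<open>Supplies the row condition for WOT-closedness of the commutant of \<open>R\<close>, and
  later the comparison of coefficients.\<close>

lemma right_op_coord:
  assumes R: "right_op_for r u R" and h: "h \<in> l2 (paths G)"
  shows "composable G w u \<Longrightarrow> R h (path_comp w u) = r w u * h w"
    and "(\<And>w. composable G w u \<Longrightarrow> x \<noteq> path_comp w u) \<Longrightarrow> R h x = 0"
proof -
  have "R \<in> bounded_ops (paths G)" "{v. composable G v u} \<subseteq> paths G"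
    using R by (auto simp: right_op_for_def composable_def)
  note c = weighted_shift_coord[OF this(1) inj_on_comp_right this(2) _ h, of "\<lambda>v. complex_of_real (r v u)"]
  show "composable G w u \<Longrightarrow> R h (path_comp w u) = r w u * h w"
    by (rule c) (use R in \<open>auto simp: right_op_for_def\<close>)
  show "R h x = 0" if "\<And>w. composable G w u \<Longrightarrow> x \<noteq> path_comp w u"
  proof (rule c)
    show "x \<notin> (\<lambda>v. path_comp v u) ` {v. composable G v u}" using that by blast
  qed (use R in \<open>auto simp: right_op_for_def\<close>)
qed

text \<open>Applied to \<open>ket v\<close>, both products are multiples of the basis vector of
  \<open>wvu\<close>, and the companion identity equates the factors. If \<open>wv\<close> or
  \<open>vu\<close> is not a path, both products vanish.\<close>

lemma left_op_right_op_commute: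
  assumes l: "left_weight G l" "left_bounded G l" and c: "right_companion G l r"
    and w: "w \<in> paths G" and R: "right_op_for r u R"
  shows "left_op G l w \<circ> R = R \<circ> left_op G l w"
proof (rule bounded_ops_eqI)
  note L = left_op_in_bounded_ops[OF l w]
  have R': "R \<in> bounded_ops (paths G)" and Rk: "\<And>v. v \<in> paths G \<Longrightarrow> R (ket v) =
      (if composable G v u then (\<lambda>x. complex_of_real (r v u) * ket (path_comp v u) x) else (\<lambda>_. 0))"
    using R by (auto simp: right_op_for_def)
  show "left_op G l w \<circ> R \<in> bounded_ops (paths G)" "R \<circ> left_op G l w \<in> bounded_ops (paths G)"
    by (intro bounded_ops_comp L R')+
  fix v assume v: "v \<in> paths G"
  have LR: "left_op G l w (R (ket v)) = (if composable G w v \<and> composable G v u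
      then (\<lambda>x. r v u * (l (path_comp v u) w * ket (path_comp w (path_comp v u)) x)) else (\<lambda>_. 0))"
  proof (cases "composable G v u")
    case True
    note vu = path_comp_in[OF True]
    show ?thesis
      using True by (simp add: Rk[OF v] bounded_ops_scale[OF L(1) ket_in_l2[OF vu]] L(2)[OF vu] composable_comp_right)
  qed (simp add: Rk[OF v] bounded_ops_zero[OF L(1)])
  have RL: "R (left_op G l w (ket v)) = (if composable G w v \<and> composable G v u
      then (\<lambda>x. l v w * (r (path_comp w v) u * ket (path_comp (path_comp w v) u) x)) else (\<lambda>_. 0))"
  proof (cases "composable G w v")
    case True
    note wv = path_comp_in[OF True]
    show ?thesis
      using True by (simp add: L(2)[OF v] bounded_ops_scale[OF R' ket_in_l2[OF wv]] Rk[OF wv] composable_comp_left)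
  qed (simp add: L(2)[OF v] bounded_ops_zero[OF R'])
  have "complex_of_real (r v u) * l (path_comp v u) w = l v w * r (path_comp w v) u"
    if "composable G w v" "composable G v u"
    using c that unfolding right_companion_def of_real_mult[symmetric]
    by (metis mult.commute)
  then show "(left_op G l w \<circ> R) (ket v) = (R \<circ> left_op G l w) (ket v)"
    by (simp add: LR RL path_comp_assoc mult.assoc[symmetric])
qed

section \<open>The left algebra and the operators commuting with the right creation
  operators\<close>

lemma left_algebra_bounded:
  assumes "left_weight G l" "left_bounded G l"
  shows "left_algebra G l \<subseteq> bounded_ops (paths G)"
  unfolding left_algebra_def
  by (rule wot_algebra_generated_bounded) (use left_op_in_bounded_ops(1)[OF assms] in auto)

text \<open>The commutant of \<open>R\<close> is a WOT-closed unital algebra containing the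
  generators, so it contains the whole left algebra.\<close>

lemma right_op_in_commutant:
  assumes l: "left_weight G l" "left_bounded G l" and c: "right_companion G l r"
    and R: "right_op_for r u R"
  shows "R \<in> commutant (paths G) (left_algebra G l)"
proof -
  let ?I = "paths G"
  have R': "R \<in> bounded_ops ?I" using R by (simp add: right_op_for_def)
  have row: "\<exists>c. \<exists>w\<in>?I. \<forall>h\<in>l2 ?I. R h x = c * h w" if x: "x \<in> ?I" for x
  proof (cases "\<exists>w. composable G w u \<and> x = path_comp w u")
    case True
    then obtain w where w: "composable G w u" "x = path_comp w u" by blast
    then have "w \<in> ?I" by (simp add: composable_def)
    then show ?thesis using right_op_coord(1)[OF R _ w(1)] w(2) by blast
  next
    case False
    then have "R h x = 0" if "h \<in> l2 ?I" for h using right_op_coord(2)[OF R that, of x] by blast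
    then have "\<forall>h\<in>l2 ?I. R h x = 0 * h x" by simp
    then show ?thesis using x by blast
  qed
  have "left_algebra G l \<subseteq> commutant ?I {R}"
    unfolding left_algebra_def wot_algebra_generated_def
  proof (rule hull_minimal)
    show "{left_op G l w |w. w \<in> ?I \<and> weight_sup G l w < \<infinity>} \<subseteq> commutant ?I {R}"
      using left_op_in_bounded_ops(1)[OF l] left_op_right_op_commute[OF l c _ R]
      by (auto simp: commutant_def)
    show "unital_subalgebra ?I (commutant ?I {R}) \<and> closedin (wot ?I) (commutant ?I {R})"
      using unital_subalgebra_commutant[OF R'] closedin_wot_commutant_row[OF R' row] by blast
  qed
  then show ?thesis
    using R' by (fastforce simp: commutant_def)
qed

text \<open>Evaluate \<open>AR = RA\<close> at the vertex vector of \<open>r(v)\<close>, which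
  \<open>R\<close> maps to a positive multiple of \<open>ket v\<close>. Hence
  \<open>A (ket v)\<close> is supported on paths \<open>wv\<close> and determined by the image of
  that vertex vector.\<close>

lemma right_op_commutant_coord:
  assumes A: "A \<in> bounded_ops (paths G)" and r: "right_weight G r" and v: "v \<in> paths G"
    and R: "right_op_for r v R" and comm: "A \<circ> R = R \<circ> A"
  defines "x \<equiv> vertex_path (path_rng G v)"
  shows "composable G w v \<Longrightarrow> r x v * A (ket v) (path_comp w v) = r w v * A (ket x) w"
    and "(\<And>w. composable G w v \<Longrightarrow> u \<noteq> path_comp w v) \<Longrightarrow> A (ket v) u = 0"
proof -
  note x = vertex_path_rng_in_paths[OF v, folded x_def] composable_vertex_left[OF v, folded x_def]
  have pos: "r x v > 0" using r x v by (simp add: right_weight_def)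
  have "A (R (ket x)) = R (A (ket x))"
    using comm by (metis comp_apply)
  also have "R (ket x) = (\<lambda>u. r x v * ket v u)"
    using R x by (simp add: right_op_for_def)
  finally have *: "r x v * A (ket v) u = R (A (ket x)) u" for u
    unfolding bounded_ops_scale[OF A ket_in_l2[OF v]] by (rule fun_cong)
  note h = bounded_ops_l2[OF A, of "ket x"]
  show "r x v * A (ket v) (path_comp w v) = r w v * A (ket x) w" if "composable G w v"
    using right_op_coord(1)[OF R h that] by (simp add: *)
  show "A (ket v) u = 0" if "\<And>w. composable G w v \<Longrightarrow> u \<noteq> path_comp w v"
    using *[of u] right_op_coord(2)[OF R h that] pos by simp
qed

text \<open>The coefficient of \<open>left_op G l w\<close> in the formal expansion of
  \<open>A\<close>: this operator sends the vertex vector of \<open>s(w)\<close> to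
  \<open>ket w\<close> times the weight in the denominator.\<close>

definition fourier_coeff ::
    "('a, 'b) weight \<Rightarrow> ((('a, 'b) gpath \<Rightarrow> complex) \<Rightarrow> ('a, 'b) gpath \<Rightarrow> complex) \<Rightarrow> ('a, 'b) gpath \<Rightarrow> complex"
  where "fourier_coeff l A w =
    A (ket (vertex_path (path_src w))) w / l (vertex_path (path_src w)) w"

text \<open>There may be infinitely many paths of length \<open>j\<close>. Cutting the outputs down
  to those whose final segment lies in a finite set \<open>F\<close> yields a finite combination of
  left creation operators, while as a compression it keeps the bound \<open>C\<close>; then
  \<open>F\<close> grows.\<close>

lemma homogeneous_part_in_wot_closed_algebra:
  assumes l: "left_weight G l" "left_bounded G l" and c: "right_companion G l r"
    and A: "A \<in> bounded_ops (paths G)"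
    and comm: "\<And>v. v \<in> paths G \<Longrightarrow> \<exists>R. right_op_for r v R \<and> A \<circ> R = R \<circ> A"
    and S: "unital_subalgebra (paths G) S" "closedin (wot (paths G)) S"
    and L: "\<And>w. w \<in> paths G \<Longrightarrow> left_op G l w \<in> S"
  shows "homogeneous_part (paths G) path_len j A \<in> S"
proof -
  let ?I = "paths G" and ?H = "homogeneous_part (paths G) path_len j A"
  define W where "W = {w \<in> ?I. path_len w = j}"
  define X where "X F = {u. j \<le> path_len u \<and> final_segment j u \<in> F}" for F
  define T where "T F = compression ?I (X F) UNIV ?H" for F
  have r: "right_weight G r" using c by (simp add: right_companion_def)
  obtain C where C: "0 \<le> C" "op_bound ?I C A" using bounded_ops_obtain_bound[OF A] .
  note H = homogeneous_part_bounded[OF C(2) A C(1)]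
  have T: "T F \<in> bounded_ops ?I" "op_bound ?I C (T F)" for F
    unfolding T_def by (rule compression_bounded[OF H(1) C(1) H(2)])+
  have "limitin (wot ?I) T ?H (finite_subsets_at_top W)"
  proof (rule limitin_wotI[OF H T])
    fix f u assume f: "f \<in> l2 ?I" and u: "u \<in> ?I"
    \<comment> \<open>The coordinate is eventually constant: it is exact once \<open>F\<close>
      contains the final segment of \<open>u\<close>.\<close>
    have "\<forall>\<^sub>F F in finite_subsets_at_top W. T F f u = ?H f u"
    proof (cases "j \<le> path_len u")
      case True
      have "\<forall>\<^sub>F F in finite_subsets_at_top W. finite F \<and> {final_segment j u} \<subseteq> F \<and> F \<subseteq> W"
        unfolding eventually_finite_subsets_at_top
        by (rule exI[of _ "{final_segment j u}"])
          (use final_segment_in_paths[OF u True] in \<open>auto simp: W_def\<close>)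
      then show ?thesis
        by (rule eventually_mono) (use f True in \<open>auto simp: T_def compression_def restr_def X_def\<close>)
    qed (use f in \<open>simp add: T_def compression_def restr_def homogeneous_part_def\<close>)
    then show "((\<lambda>F. T F f u) \<longlongrightarrow> ?H f u) (finite_subsets_at_top W)"
      by (rule tendsto_eventually)
  qed
  moreover have "T F \<in> S" if F: "finite F" "F \<subseteq> W" for F
  proof -
    let ?T = "\<lambda>f i. \<Sum>w\<in>F. fourier_coeff l A w * left_op G l w f i"
    have FI: "w \<in> ?I" "path_len w = j" if "w \<in> F" for w using F that by (auto simp: W_def)
    have "T F = ?T"
    proof (rule bounded_ops_eqI[OF T(1)])
      show "?T \<in> bounded_ops ?I"
        using F FI by (intro bounded_ops_sum left_op_in_bounded_ops[OF l]) auto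
      fix v assume v: "v \<in> ?I"
      obtain R where R: "right_op_for r v R" "A \<circ> R = R \<circ> A" using comm[OF v] by blast
      note coord = right_op_commutant_coord[OF A r v R]
      show "T F (ket v) = ?T (ket v)"
      proof
        fix u
        have Tu: "T F (ket v) u = (if u \<in> X F \<and> path_len u = path_len v + j then A (ket v) u else 0)"
          using ket_in_l2[OF v]
          by (auto simp: T_def compression_def homogeneous_part_def restr_apply X_def
              restr_ket level_def bounded_ops_zero[OF A])
        have shift: "left_op G l w (ket v) u = (if composable G w v \<and> u = path_comp w v then l v w else 0)"
          if "w \<in> F" for w
          using left_op_in_bounded_ops(2)[OF l FI(1)[OF that] v] by (simp add: ket_def)
        have seg: "final_segment j u = w" if "w \<in> F" "composable G w v" "u = path_comp w v" for w
          using final_segment_comp[OF that(2)] FI(2)[OF that(1)] that(3) by simp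
        show "T F (ket v) u = ?T (ket v) u"
        proof (cases "\<exists>w\<in>F. composable G w v \<and> u = path_comp w v")
          case True
          then obtain w where w: "w \<in> F" "composable G w v" "u = path_comp w v" by blast
          define x :: "('a, 'b) gpath" where "x = vertex_path (path_rng G v)"
          have src: "vertex_path (path_src w) = x"
            using w(2) by (simp add: x_def composable_def)
          \<comment> \<open>By uniqueness of the final segment, only one path in \<open>F\<close>
            carries \<open>v\<close> to \<open>u\<close>.\<close>
          have "?T (ket v) u = (\<Sum>w'\<in>F. if w' = w then fourier_coeff l A w * l v w else 0)"
          proof (rule sum.cong[OF refl])
            fix w' assume w': "w' \<in> F"
            have "composable G w' v \<and> u = path_comp w' v \<longleftrightarrow> w' = w"
              using seg[OF w'] seg[OF w] w w' by metis
            then show "fourier_coeff l A w' * left_op G l w' (ket v) u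
                = (if w' = w then fourier_coeff l A w * l v w else 0)"
              using shift[OF w'] by simp
          qed
          also have "\<dots> = fourier_coeff l A w * l v w" using F w by simp
          also have "\<dots> = A (ket v) u"
          proof -
            note wx = composable_vertex_right[OF w(2), folded x_def]
            note xv = composable_vertex_left[OF v, folded x_def]
            \<comment> \<open>The companion identity with the vertex \<open>x\<close> as middle
              path, where \<open>wx = w\<close> and \<open>xv = v\<close>.\<close>
            have "r w v * l x w = l v w * r x v"
              using c wx xv unfolding right_companion_def by metis
            then have "complex_of_real (r w v) * l x w = l v w * r x v"
              by (metis of_real_mult)
            moreover have "l x w > 0" "r x v > 0"
              using l(1) r wx xv FI(1)[OF w(1)] v
              by (auto simp: left_weight_def right_weight_def composable_def)
            moreover have "r x v * A (ket v) u = r w v * A (ket x) w"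
              using coord(1)[OF w(2)] w(3) by (simp add: x_def)
            ultimately have "r x v * (A (ket v) u * l x w) = r x v * (A (ket x) w * l v w)"
              by (simp only: mult.assoc[symmetric]) (simp add: mult.commute mult.left_commute)
            with \<open>l x w > 0\<close> \<open>r x v > 0\<close> show ?thesis
              by (simp add: fourier_coeff_def src field_simps)
          qed
          also have "\<dots> = T F (ket v) u"
          proof -
            have "path_len u = path_len v + j"
              using w(3) FI(2)[OF w(1)] by (simp add: path_len_comp)
            moreover have "u \<in> X F"
              using seg[OF w] w(1) calculation by (simp add: X_def)
            ultimately show ?thesis by (simp add: Tu)
          qed
          finally show ?thesis by simp
        next
          case False
          then have "?T (ket v) u = 0" by (auto simp: shift intro!: sum.neutral)
          \<comment> \<open>A path \<open>u = wv\<close> of this length would have \<open>w\<close>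
            as its final segment of length \<open>j\<close>, putting \<open>w\<close> in
            \<open>F\<close> against the case assumption.\<close>
          moreover have "A (ket v) u = 0" if u: "u \<in> X F" "path_len u = path_len v + j"
          proof (rule coord(2))
            fix w assume w: "composable G w v"
            show "u \<noteq> path_comp w v"
            proof
              assume "u = path_comp w v"
              moreover from this have "path_len w = j" using u(2) by (simp add: path_len_comp)
              ultimately show False
                using False w u(1) final_segment_comp[OF w] by (auto simp: X_def)
            qed
          qed
          ultimately show ?thesis by (simp add: Tu)
        qed
      qed
    qed
    then show ?thesis
      using unital_subalgebra_sum[OF S(1) F(1), of "left_op G l" "fourier_coeff l A"] L FI(1) by simp
  qed
  then have "\<forall>\<^sub>F F in finite_subsets_at_top W. T F \<in> S"
    by (intro eventually_finite_subsets_at_top_weakI)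
  ultimately show ?thesis
    using S(2) by (intro limitin_closedin[of "wot ?I" T ?H "finite_subsets_at_top W" S]) auto
qed

text \<open>The vector \<open>A (ket v)\<close> is supported on paths \<open>wv\<close>, which are
  at least as long as \<open>v\<close>.\<close>

lemma commutant_right_ops_lower_triangular:
  assumes A: "A \<in> bounded_ops (paths G)" and r: "right_weight G r"
    and comm: "\<And>v. v \<in> paths G \<Longrightarrow> \<exists>R. right_op_for r v R \<and> A \<circ> R = R \<circ> A"
  shows "lower_triangular (paths G) path_len A"
  unfolding lower_triangular_def
proof (intro ballI allI impI)
  fix v u :: "('a, 'b) gpath" assume v: "v \<in> paths G" and less: "path_len u < path_len v"
  obtain R where R: "right_op_for r v R" "A \<circ> R = R \<circ> A" using comm[OF v] by blast
  show "A (ket v) u = 0"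
  proof (rule right_op_commutant_coord(2)[OF A r v R])
    fix w
    show "u \<noteq> path_comp w v"
      using less path_len_comp[of w v] by auto
  qed
qed

end

theorem theorem4p2:
  fixes G :: "('v, 'e) pre_digraph" and l r :: "('v, 'e) weight"
  assumes "wf_digraph G" and "countable (verts G)" and "countable (arcs G)"
    and "left_weight G l" and "left_bounded G l"
    and "canonical_right_companion G l r" and "right_bounded G r"
  shows "commutant (paths G) (commutant (paths G) (left_algebra G l)) = left_algebra G l"
proof
  interpret wf_digraph G by fact
  note l = assms(4,5)
  have c: "right_companion G l r" using assms(6) by (simp add: canonical_right_companion_def)
  then have r: "right_weight G r" by (simp add: right_companion_def)
  show "left_algebra G l \<subseteq> commutant (paths G) (commutant (paths G) (left_algebra G l))"
    by (rule subset_double_commutant[OF left_algebra_bounded[OF l]])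
  show "commutant (paths G) (commutant (paths G) (left_algebra G l)) \<subseteq> left_algebra G l"
  proof
    fix A assume A: "A \<in> commutant (paths G) (commutant (paths G) (left_algebra G l))"
    have bdd: "A \<in> bounded_ops (paths G)" using A by (simp add: commutant_def)
    have comm: "\<exists>R. right_op_for r v R \<and> A \<circ> R = R \<circ> A" if v: "v \<in> paths G" for v
    proof -
      obtain R where R: "right_op_for r v R" using right_op_exists[OF r assms(7) v] .
      then show ?thesis using right_op_in_commutant[OF l c R] A by (auto simp: commutant_def)
    qed
    show "A \<in> left_algebra G l"
      unfolding left_algebra_def wot_algebra_generated_def hull_def
    proof (rule InterI, clarify)
      fix S assume S: "{left_op G l w |w. w \<in> paths G \<and> weight_sup G l w < \<infinity>} \<subseteq> S"
        "unital_subalgebra (paths G) S" "closedin (wot (paths G)) S"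
      \<comment> \<open>Left-boundedness makes every path index a generator, so \<open>S\<close>
        contains all the left creation operators of the expansion.\<close>
      have "left_op G l w \<in> S" if "w \<in> paths G" for w
        using subsetD[OF S(1), of "left_op G l w"] l(2) that unfolding left_bounded_def by blast
      from homogeneous_part_in_wot_closed_algebra[OF l c bdd comm S(2,3) this]
      show "A \<in> S"
        by (intro wot_closed_memI_homogeneous_parts[OF bdd
              commutant_right_ops_lower_triangular[OF bdd r comm] S(2,3)])
    qed
  qed
qed

end
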